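(* Let $\tilde m,d\ge 1$, let $S=S_{\tilde m d}$ be a constant real skew-symmetric $\tilde m d\times\tilde m d$ matrix, let $H:(\mathbb{R}^d)^{\tilde m}\to\mathbb{R}$ be sufficiently differentiable, and consider the Hamiltonian system $\dot z=S\nabla H(z)$ with $z=(\tilde z_1,\dots,\tilde z_{\tilde m})$, $\tilde z_k\in\mathbb{R}^d$. Let $\Psi_\tau$ be the PAVF-C (composition) method and $\hat\Psi_\tau$ the PAVF-P (plus) method for this system, as defined in the context. Then $\Psi_\tau$ and $\hat\Psi_\tau$ are both methods of order two, and both conserve the energy exactly: if $z^{n+1}$ is obtained from $z^n$ by one step of $\Psi_\tau$, or by one step of $\hat\Psi_\tau$, then $H(z^{n+1})=H(z^n)$.
   Context: For $z,\bar z\in(\mathbb{R}^d)^{\tilde m}$ let $G(z,\bar z)\in(\mathbb{R}^d)^{\tilde m}$ be the vector whose $k$-th block is $$G_k(z,\bar z)=\int_0^1 H_{\tilde z_k}\big(\bar z_1,\dots,\bar z_{k-1},\;\xi\bar z_k+(1-\xi)z_k,\;z_{k+1},\dots,z_{\tilde m}\big)\,d\xi,$$ and let $G^*(z,\bar z)$ be the vector whose $k$-th block is $$G^*_k(z,\bar z)=\int_0^1 H_{\tilde z_k}\big(z_1,\dots,z_{k-1},\;\xi\bar z_k+(1-\xi)z_k,\;\bar z_{k+1},\dots,\bar z_{\tilde m}\big)\,d\xi .$$ Here $z_k,\bar z_k\in\mathbb{R}^d$ are the $k$-th blocks of $z,\bar z$, and $H_{\tilde z_k}$ is the gradient of $H$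 with respect to its $k$-th block. The PAVF method $\Phi_\tau: z^n\mapsto z^{n+1}$ with time step $\tau$ is defined implicitly by $\frac1\tau(z^{n+1}-z^n)=S\,G(z^n,z^{n+1})$. Its adjoint $\Phi_\tau^*:z^n\mapsto z^{n+1}$ (that is, $\Phi^*_\tau=\Phi_{-\tau}^{-1}$) is defined by $\frac1\tau(z^{n+1}-z^n)=S\,G^*(z^n,z^{n+1})$. The PAVF-C method is $\Psi_\tau:=\Phi^*_{\tau/2}\circ\Phi_{\tau/2}$; i.e. there is an intermediate value $z^*$ with $\frac{2}{\tau}(z^*-z^n)=S\,G(z^n,z^* )$ and $\frac{2}{\tau}(z^{n+1}-z^* )=S\,G^*(z^*,z^{n+1})$. The PAVF-P method $\hat\Psi_\tau$, written symbolically $\frac12(\Phi_\tau^*+\Phi_\tau)$, is the one-step method $z^n\mapsto z^{n+1}$ obtained by averaging the two schemes: $$\frac1\tau(z^{n+1}-z^n)=\tfrac12\,S\big(G(z^n,z^{n+1})+G^*(z^n,z^{n+1})\big).$$ The implicit relations are understood to define $z^{n+1}$ (and $z^*$) as the solution close to $z^n$ for small $\tau$. A one-step method $\chi_\tau$ has order two if, for every $z$, $\chi_\tau(z)-\varphi_\tau(z)=O(\tau^3)$ as $\tau\to0$, where $\varphi_\tau$ is the exact flow of $\dot z=S\nabla H(z)$. "Sufficiently differentiable" is the paper's standing assumption on $H$. *)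

theory Defs
  imports "HOL-Analysis.Analysis" "HOL-Library.Landau_Symbols"
begin

text \<open>
  A state in \<open>(\<real>\<^sup>d)\<^sup>m\<close> is a vector of blocks, of type \<open>real ^ 'd ^ 'm\<close>. The blocks are ordered
  by the linear order of their finite index type \<open>'m\<close>.
\<close>

type_synonym ('d, 'm) blocks = "((real, 'd) vec, 'm) vec"

text \<open>
  Class \<open>C\<^sup>n\<close>, in terms of iterated directional derivatives; in finite dimension this is the usual
  notion.
\<close>

primrec cont_diff :: "nat \<Rightarrow> ('a::euclidean_space \<Rightarrow> 'b::real_normed_vector) \<Rightarrow> bool" where
  "cont_diff 0 f \<longleftrightarrow> continuous_on UNIV f"
| "cont_diff (Suc n) f \<longleftrightarrow>
     (\<forall>x. f differentiable (at x)) \<and>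
     (\<forall>v. cont_diff n (\<lambda>x. frechet_derivative f (at x) v))"

definition gradient :: "('a::real_inner \<Rightarrow> real) \<Rightarrow> 'a \<Rightarrow> 'a" where
  "gradient f x = (THE D. GDERIV f x :> D)"

definition block_gradient ::
  "(('d::finite, 'm::finite) blocks \<Rightarrow> real) \<Rightarrow> 'm \<Rightarrow> ('d, 'm) blocks \<Rightarrow> real ^ 'd" where
  "block_gradient H k z = gradient (\<lambda>w. H (\<chi> j. if j = k then w else z $ j)) (z $ k)"

text \<open>
  The matrix \<open>S\<close> has its rows and columns indexed by pairs (block, component within the block);
  \<open>block_mult S\<close> is its action on a state written in blocks.
\<close>

type_synonym ('d, 'm) block_matrix = "((real, 'm \<times> 'd) vec, 'm \<times> 'd) vec"

definition flatten :: "('d::finite, 'm::finite) blocks \<Rightarrow> real ^ ('m \<times> 'd)" where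
  "flatten z = (\<chi> p. z $ fst p $ snd p)"

definition unflatten :: "real ^ ('m \<times> 'd) \<Rightarrow> ('d::finite, 'm::finite) blocks" where
  "unflatten v = (\<chi> k i. v $ (k, i))"

definition block_mult ::
  "('d::finite, 'm::finite) block_matrix \<Rightarrow> ('d, 'm) blocks \<Rightarrow> ('d, 'm) blocks" where
  "block_mult S z = unflatten (S *v flatten z)"

definition pavf_gradient ::
  "(('d::finite, 'm::{finite,linorder}) blocks \<Rightarrow> real) \<Rightarrow> ('d, 'm) blocks \<Rightarrow> ('d, 'm) blocks \<Rightarrow> ('d, 'm) blocks"
where
  "pavf_gradient H z z' = (\<chi> k. integral {0..1} (\<lambda>\<xi>. block_gradient H k
     (\<chi> j. if j < k then z' $ j
           else if j = k then \<xi> *\<^sub>R z' $ k + (1 - \<xi>) *\<^sub>R z $ k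
           else z $ j)))"

definition pavf_adj_gradient ::
  "(('d::finite, 'm::{finite,linorder}) blocks \<Rightarrow> real) \<Rightarrow> ('d, 'm) blocks \<Rightarrow> ('d, 'm) blocks \<Rightarrow> ('d, 'm) blocks"
where
  "pavf_adj_gradient H z z' = (\<chi> k. integral {0..1} (\<lambda>\<xi>. block_gradient H k
     (\<chi> j. if j < k then z $ j
           else if j = k then \<xi> *\<^sub>R z' $ k + (1 - \<xi>) *\<^sub>R z $ k
           else z' $ j)))"

text \<open>
  The implicit relations between \<open>z = z\<^sup>n\<close> and \<open>z' = z\<^sup>n\<^sup>+\<^sup>1\<close>. They are meaningful for \<open>\<tau> \<noteq> 0\<close> only,
  since \<open>1 / 0 = 0\<close> in HOL.
\<close>

definition pavf_step ::
  "('d::finite, 'm::{finite,linorder}) block_matrix \<Rightarrow> (('d, 'm) blocks \<Rightarrow> real) \<Rightarrow> real \<Rightarrow>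
    ('d, 'm) blocks \<Rightarrow> ('d, 'm) blocks \<Rightarrow> bool" where
  "pavf_step S H \<tau> z z' \<longleftrightarrow>
     (1 / \<tau>) *\<^sub>R (z' - z) = block_mult S (pavf_gradient H z z')"

definition pavf_adj_step ::
  "('d::finite, 'm::{finite,linorder}) block_matrix \<Rightarrow> (('d, 'm) blocks \<Rightarrow> real) \<Rightarrow> real \<Rightarrow>
    ('d, 'm) blocks \<Rightarrow> ('d, 'm) blocks \<Rightarrow> bool" where
  "pavf_adj_step S H \<tau> z z' \<longleftrightarrow>
     (1 / \<tau>) *\<^sub>R (z' - z) = block_mult S (pavf_adj_gradient H z z')"

definition pavf_c_step ::
  "('d::finite, 'm::{finite,linorder}) block_matrix \<Rightarrow> (('d, 'm) blocks \<Rightarrow> real) \<Rightarrow> real \<Rightarrow>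
    ('d, 'm) blocks \<Rightarrow> ('d, 'm) blocks \<Rightarrow> bool" where
  "pavf_c_step S H \<tau> z z' \<longleftrightarrow>
     (\<exists>zs. pavf_step S H (\<tau> / 2) z zs \<and> pavf_adj_step S H (\<tau> / 2) zs z')"

definition pavf_p_step ::
  "('d::finite, 'm::{finite,linorder}) block_matrix \<Rightarrow> (('d, 'm) blocks \<Rightarrow> real) \<Rightarrow> real \<Rightarrow>
    ('d, 'm) blocks \<Rightarrow> ('d, 'm) blocks \<Rightarrow> bool" where
  "pavf_p_step S H \<tau> z z' \<longleftrightarrow>
     (1 / \<tau>) *\<^sub>R (z' - z) =
       (1 / 2) *\<^sub>R block_mult S (pavf_gradient H z z' + pavf_adj_gradient H z z')"

text \<open>
  An implicit relation \<open>R \<tau> z z'\<close> defines the map taking \<open>z\<close> to the solution \<open>z'\<close> close to \<open>z\<close>, read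
  as the solution at minimal distance from \<open>z\<close>. If \<open>R\<close> has, for small \<open>\<tau>\<close>, exactly one solution in
  some fixed neighbourhood of \<open>z\<close>, and it tends to \<open>z\<close> as \<open>\<tau> \<rightarrow> 0\<close>, this is that solution. The value
  is unspecified if there is no nearest solution.
\<close>

definition close_solution ::
  "(real \<Rightarrow> 'a \<Rightarrow> 'a \<Rightarrow> bool) \<Rightarrow> real \<Rightarrow> 'a \<Rightarrow> 'a::metric_space" where
  "close_solution R \<tau> z = arg_min (dist z) (R \<tau> z)"

definition pavf ::
  "('d::finite, 'm::{finite,linorder}) block_matrix \<Rightarrow> (('d, 'm) blocks \<Rightarrow> real) \<Rightarrow> real \<Rightarrow>
    ('d, 'm) blocks \<Rightarrow> ('d, 'm) blocks" where
  "pavf S H = close_solution (pavf_step S H)"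

definition pavf_adj ::
  "('d::finite, 'm::{finite,linorder}) block_matrix \<Rightarrow> (('d, 'm) blocks \<Rightarrow> real) \<Rightarrow> real \<Rightarrow>
    ('d, 'm) blocks \<Rightarrow> ('d, 'm) blocks" where
  "pavf_adj S H = close_solution (pavf_adj_step S H)"

definition pavf_c ::
  "('d::finite, 'm::{finite,linorder}) block_matrix \<Rightarrow> (('d, 'm) blocks \<Rightarrow> real) \<Rightarrow> real \<Rightarrow>
    ('d, 'm) blocks \<Rightarrow> ('d, 'm) blocks" where
  "pavf_c S H \<tau> = pavf_adj S H (\<tau> / 2) \<circ> pavf S H (\<tau> / 2)"

definition pavf_p ::
  "('d::finite, 'm::{finite,linorder}) block_matrix \<Rightarrow> (('d, 'm) blocks \<Rightarrow> real) \<Rightarrow> real \<Rightarrow>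
    ('d, 'm) blocks \<Rightarrow> ('d, 'm) blocks" where
  "pavf_p S H = close_solution (pavf_p_step S H)"

text \<open>
  \<open>exact_solution F z \<phi>\<close>: near time \<open>0\<close>, \<open>\<phi> t\<close> is the exact flow of \<open>x' = F x\<close> applied to \<open>z\<close>.
\<close>

definition exact_solution ::
  "('a::real_normed_vector \<Rightarrow> 'a) \<Rightarrow> 'a \<Rightarrow> (real \<Rightarrow> 'a) \<Rightarrow> bool" where
  "exact_solution F z \<phi> \<longleftrightarrow>
     \<phi> 0 = z \<and> (\<forall>\<^sub>F t in nhds 0. (\<phi> has_vector_derivative F (\<phi> t)) (at t))"

definition has_order ::
  "nat \<Rightarrow> ('a::real_normed_vector \<Rightarrow> 'a) \<Rightarrow> (real \<Rightarrow> 'a \<Rightarrow> 'a) \<Rightarrow> bool" where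
  "has_order p F \<Psi> \<longleftrightarrow>
     (\<forall>z \<phi>. exact_solution F z \<phi> \<longrightarrow>
        (\<lambda>\<tau>. norm (\<Psi> \<tau> z - \<phi> \<tau>)) \<in> O[at 0](\<lambda>\<tau>. \<tau> ^ (p + 1)))"

end

theory Submission imports Defs begin

text \<open>
  Energy: moving the blocks from \<open>z\<close> to \<open>z'\<close> one after the other and applying the fundamental
  theorem of calculus to each move gives \<open>G z z' \<bullet> (z' - z) = H z' - H z\<close>, and \<open>S\<close> is skew.
  Since \<open>G\<^sup>* z z' = G z' z\<close>, the adjoint scheme is the original one run backwards.

  Order: \<open>\<nabla>H\<close> has a Taylor expansion with locally uniform quadratic remainder. In each method the
  two discrete gradients evaluate \<open>\<nabla>H\<close> at pairs of points that are (nearly) symmetric about some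
  \<open>m = z + (\<tau>/2) f(z) + O(\<tau>\<^sup>2)\<close>, where \<open>f = S \<nabla>H\<close>. Hence one step equals
  \<open>z + \<tau> f(m) + O(\<tau>\<^sup>3)\<close>, which agrees with the flow to order two.
\<close>

section \<open>Taylor expansion of the gradient\<close>

text \<open>The methods are \<open>arg_min\<close> selections from implicit relations, so an order
  estimate has a meaning only once solutions near \<open>z\<close> exist and the selected one is
  known to lie within O(\<tau>) of \<open>z\<close>. After that the implicit solution itself is
  never expanded. The factor \<tau> in front of \<open>f(m)\<close> already supplies one power, so
  errors of size O(\<tau>^2) in \<open>m\<close> and in the mean of the two discrete gradients
  suffice: the former follows from Lipschitz bounds, the latter from the cancellation of linear
  terms. Since the centre of symmetry moves with \<tau>, the Taylor estimate has to hold with one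
  constant at all base points of a ball. \<open>taylor_on\<close> records just that:
  \<open>A a\<close> is any linear map acting as derivative at \<open>a\<close>, and the single
  constant \<open>L\<close> bounds both its operator norm and the quadratic remainder.\<close>

definition taylor_on :: "('a::real_normed_vector \<Rightarrow> 'a \<Rightarrow> 'b::real_normed_vector) \<Rightarrow> real \<Rightarrow> 'a set \<Rightarrow> ('a \<Rightarrow> 'b) \<Rightarrow> bool"
where
  "taylor_on A L X g \<longleftrightarrow> 0 \<le> L \<and> (\<forall>a\<in>X. linear (A a) \<and> (\<forall>v. norm (A a v) \<le> L * norm v) \<and>
     (\<forall>w\<in>X. norm (g w - g a - A a (w - a)) \<le> L * (norm (w - a))\<^sup>2))"

lemma taylor_onD:
  assumes "taylor_on A L X g" "a \<in> X"
  shows "0 \<le> L" "linear (A a)" "norm (A a v) \<le> L * norm v"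
    "w \<in> X \<Longrightarrow> norm (g w - g a - A a (w - a)) \<le> L * (norm (w - a))\<^sup>2"
  using assms by (auto simp: taylor_on_def)

text \<open>\<open>cont_diff\<close> gives continuity of the derivative along one fixed direction at
  a time. Each of the finitely many basis directions is bounded on the compact ball, and linearity
  assembles these bounds into one for the operator.\<close>

lemma frechet_derivative_bounded_on_cball:
  fixes q :: "'a::euclidean_space \<Rightarrow> 'b::real_normed_vector"
  assumes "\<And>x. q differentiable (at x)"
    and "\<And>b. b \<in> Basis \<Longrightarrow> continuous_on UNIV (\<lambda>x. frechet_derivative q (at x) b)"
  obtains B where "0 \<le> B"
    "\<And>x v. x \<in> cball z r \<Longrightarrow> norm (frechet_derivative q (at x) v) \<le> B * norm v"
proof -
  let ?D = "\<lambda>x. frechet_derivative q (at x)"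
  have "\<exists>c. \<forall>x\<in>cball z r. norm (?D x b) \<le> c" if "b \<in> Basis" for b
  proof -
    have "bounded ((\<lambda>x. ?D x b) ` cball z r)"
      by (intro compact_imp_bounded compact_continuous_image)
         (auto intro: continuous_on_subset[OF assms(2)[OF that]])
    then show ?thesis
      by (auto simp: bounded_iff)
  qed
  then obtain c where c: "\<And>b x. b \<in> Basis \<Longrightarrow> x \<in> cball z r \<Longrightarrow> norm (?D x b) \<le> c b"
    by metis
  show ?thesis
  proof
    show "0 \<le> (\<Sum>b\<in>Basis. \<bar>c b\<bar>)"
      by (simp add: sum_nonneg)
    fix x v assume x: "x \<in> cball z r"
    have lin: "linear (?D x)"
      using assms(1) linear_frechet_derivative by blast
    have "?D x v = ?D x (\<Sum>b\<in>Basis. (v \<bullet> b) *\<^sub>R b)"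
      by (simp add: euclidean_representation)
    also have "\<dots> = (\<Sum>b\<in>Basis. (v \<bullet> b) *\<^sub>R ?D x b)"
      using lin by (simp add: linear_sum linear_cmul)
    also have "norm \<dots> \<le> (\<Sum>b\<in>Basis. \<bar>c b\<bar> * norm v)"
    proof (rule sum_norm_le)
      fix b :: 'a assume b: "b \<in> Basis"
      have "norm (?D x b) \<le> \<bar>c b\<bar>"
        using c[OF b x] by linarith
      then show "norm ((v \<bullet> b) *\<^sub>R ?D x b) \<le> \<bar>c b\<bar> * norm v"
        using Basis_le_norm[OF b, of v] by (simp add: mult_mono mult.commute)
    qed
    finally show "norm (?D x v) \<le> (\<Sum>b\<in>Basis. \<bar>c b\<bar>) * norm v"
      by (simp add: sum_distrib_right)
  qed
qed

lemma frechet_derivative_bound_imp_lipschitz: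
  fixes q :: "'a::euclidean_space \<Rightarrow> 'b::real_normed_vector"
  assumes "\<And>x. q differentiable (at x)"
    and "\<And>x v. x \<in> cball z r \<Longrightarrow> norm (frechet_derivative q (at x) v) \<le> B * norm v"
    and "x \<in> cball z r" "y \<in> cball z r"
  shows "norm (q x - q y) \<le> B * norm (x - y)"
proof (rule differentiable_bound[OF convex_cball _ _ assms(3,4)])
  fix w assume w: "w \<in> cball z r"
  show "(q has_derivative frechet_derivative q (at w)) (at w within cball z r)"
    using assms(1) frechet_derivative_works has_derivative_at_withinI by blast
  show "onorm (frechet_derivative q (at w)) \<le> B"
    by (rule onorm_le) (use assms(2)[OF w] in auto)
qed

text \<open>Bounded second derivatives make each directional derivative Lipschitz on the ball;
  summing over the basis makes the derivative itself Lipschitz with constant \<open>C\<close>, and a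
  mean value estimate turns this into a quadratic remainder. \<open>B + C\<close> serves both as
  operator bound and as remainder constant.\<close>

lemma cont_diff_2_taylor:
  fixes p :: "'a::euclidean_space \<Rightarrow> real"
  assumes "cont_diff (Suc (Suc 0)) p"
  obtains L where "taylor_on (\<lambda>x. frechet_derivative p (at x)) L (cball z r) p"
proof -
  let ?D = "\<lambda>x. frechet_derivative p (at x)"
  have dp: "p differentiable (at x)" for x
    using assms by simp
  have dq: "(\<lambda>x. ?D x b) differentiable (at x)" for x b
    using assms by simp
  have cq: "continuous_on UNIV (\<lambda>x. frechet_derivative (\<lambda>x. ?D x b) (at x) v)" for b v
    using assms by simp
  have "continuous_on UNIV (\<lambda>x. ?D x b)" for b
    using dq by (simp add: differentiable_imp_continuous_on differentiable_on_def)
  then obtain B where B: "0 \<le> B" "\<And>x v. x \<in> cball z r \<Longrightarrow> norm (?D x v) \<le> B * norm v"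
    using frechet_derivative_bounded_on_cball[OF dp] by metis
  have "\<exists>c\<ge>0. \<forall>x\<in>cball z r. \<forall>y\<in>cball z r. norm (?D x b - ?D y b) \<le> c * norm (x - y)" for b
  proof -
    obtain c where c: "0 \<le> c" "\<And>x v. x \<in> cball z r \<Longrightarrow>
        norm (frechet_derivative (\<lambda>x. ?D x b) (at x) v) \<le> c * norm v"
      using frechet_derivative_bounded_on_cball[OF dq cq] by metis
    show ?thesis
      using frechet_derivative_bound_imp_lipschitz[OF dq c(2)] c(1) by blast
  qed
  then obtain c where c: "\<And>b. 0 \<le> c b" "\<And>b x y. x \<in> cball z r \<Longrightarrow> y \<in> cball z r \<Longrightarrow>
      norm (?D x b - ?D y b) \<le> c b * norm (x - y)"
    by metis
  define C where "C = (\<Sum>b\<in>Basis. c b)"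
  have C: "0 \<le> C"
    by (simp add: C_def sum_nonneg c)
  have Dlip: "norm (?D x v - ?D y v) \<le> (C * norm (x - y)) * norm v"
    if xy: "x \<in> cball z r" "y \<in> cball z r" for x y v
  proof -
    have lin: "linear (\<lambda>v. ?D x v - ?D y v)"
      by (intro linear_compose_sub linear_frechet_derivative dp)
    have "?D x v - ?D y v = (\<lambda>v. ?D x v - ?D y v) (\<Sum>b\<in>Basis. (v \<bullet> b) *\<^sub>R b)"
      by (simp add: euclidean_representation)
    also have "\<dots> = (\<Sum>b\<in>Basis. (v \<bullet> b) *\<^sub>R (?D x b - ?D y b))"
      by (subst linear_sum[OF lin]) (use linear_cmul[OF lin] in simp)
    also have "norm \<dots> \<le> (\<Sum>b\<in>Basis. norm v * (c b * norm (x - y)))"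
    proof (rule sum_norm_le)
      fix b :: 'a assume b: "b \<in> Basis"
      show "norm ((v \<bullet> b) *\<^sub>R (?D x b - ?D y b)) \<le> norm v * (c b * norm (x - y))"
        unfolding norm_scaleR real_norm_def[of "v \<bullet> b"]
        by (intro mult_mono Basis_le_norm[OF b] c xy) (use c in auto)
    qed
    also have "\<dots> = (C * norm (x - y)) * norm v"
      by (simp add: C_def sum_distrib_left sum_distrib_right mult_ac)
    finally show ?thesis .
  qed
  have "taylor_on ?D (B + C) (cball z r) p"
    unfolding taylor_on_def
  proof (intro conjI ballI allI)
    fix a assume a: "a \<in> cball z r"
    show "linear (?D a)"
      by (rule linear_frechet_derivative[OF dp])
    show "norm (?D a v) \<le> (B + C) * norm v" for v
      using B(2)[OF a, of v] C by (simp add: distrib_right add_increasing2)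
    fix w assume w: "w \<in> cball z r"
    \<comment> \<open>Mean value inequality for \<open>p - ?D a\<close> on the segment from
      \<open>a\<close> to \<open>w\<close>, which convexity keeps inside the ball: there the
      derivative differs from \<open>?D a\<close> by at most
      \<open>C * norm (w - a)\<close>.\<close>
    have "norm (p w - p a - ?D a (w - a)) \<le> norm (w - a) * (C * norm (w - a))"
    proof (rule differentiable_bound_linearization[where S = "closed_segment a w" and f' = ?D])
      fix t :: real assume "t \<in> {0..1}"
      then show "a + t *\<^sub>R (w - a) \<in> closed_segment a w"
        by (auto simp: in_segment algebra_simps)
    next
      fix x
      show "(p has_derivative ?D x) (at x within closed_segment a w)"
        using dp frechet_derivative_works has_derivative_at_withinI by blast
      assume x: "x \<in> closed_segment a w"
      have xc: "x \<in> cball z r"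
        using x a w convex_cball by (meson convex_contains_segment subsetD)
      have "C * norm (x - a) \<le> C * norm (w - a)"
        using segment_bound(1)[OF x] C by (intro mult_left_mono)
      then have "norm (?D x v - ?D a v) \<le> (C * norm (w - a)) * norm v" for v
        using Dlip[OF xc a, of v] by (meson mult_right_mono norm_ge_zero order_trans)
      then show "onorm (?D x - ?D a) \<le> C * norm (w - a)"
        by (intro onorm_le) (simp add: fun_diff_def)
    qed auto
    also have "\<dots> \<le> (B + C) * (norm (w - a))\<^sup>2"
      using B(1) by (simp add: power2_eq_square algebra_simps)
    finally show "norm (p w - p a - ?D a (w - a)) \<le> (B + C) * (norm (w - a))\<^sup>2" .
  qed (use B C in auto)
  then show ?thesis
    using that by blast
qed

section \<open>Gradients as inner-product representatives of derivatives\<close>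

lemma gradient_eqI:
  assumes "GDERIV H x :> D"
  shows "gradient H x = D"
  unfolding gradient_def
proof (rule the_equality[where P = "\<lambda>D. GDERIV H x :> D", OF assms])
  fix E assume "GDERIV H x :> E"
  then have "(\<lambda>h. h \<bullet> E) = (\<lambda>h. h \<bullet> D)"
    using assms unfolding gderiv_def by (rule has_derivative_unique)
  then have "h \<bullet> E = h \<bullet> D" for h
    by (rule fun_cong)
  then show "E = D"
    using vector_eq_ldot by blast
qed

text \<open>The Riesz representative of the derivative, written out in the basis, is a witness for
  the definite description behind \<open>gradient\<close>.\<close>

lemma GDERIV_gradient:
  fixes H :: "'a::euclidean_space \<Rightarrow> real"
  assumes "H differentiable (at x)"
  shows "GDERIV H x :> gradient H x"
proof -
  let ?D = "frechet_derivative H (at x)"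
  define E where "E = (\<Sum>b\<in>Basis. ?D b *\<^sub>R b)"
  have lin: "linear ?D"
    by (rule linear_frechet_derivative[OF assms])
  have "?D = (\<lambda>h. h \<bullet> E)"
  proof
    fix v
    have "?D v = ?D (\<Sum>b\<in>Basis. (v \<bullet> b) *\<^sub>R b)"
      by (simp add: euclidean_representation)
    also have "\<dots> = (\<Sum>b\<in>Basis. (v \<bullet> b) * ?D b)"
      by (simp add: linear_sum[OF lin] linear_cmul[OF lin])
    finally show "?D v = v \<bullet> E"
      by (simp add: E_def inner_sum_right mult.commute)
  qed
  moreover have "(H has_derivative ?D) (at x)"
    using assms frechet_derivative_works by blast
  ultimately have "GDERIV H x :> E"
    by (simp add: gderiv_def)
  then show ?thesis
    using gradient_eqI by metis
qed

lemma frechet_derivative_eq_inner_gradient: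
  fixes H :: "'a::euclidean_space \<Rightarrow> real"
  assumes "H differentiable (at x)"
  shows "frechet_derivative H (at x) v = gradient H x \<bullet> v"
  using GDERIV_gradient[OF assms] unfolding gderiv_def
  by (metis frechet_derivative_at inner_commute)

lemma cont_diff_3_gradient:
  fixes H :: "'a::euclidean_space \<Rightarrow> real"
  assumes "cont_diff 3 H"
  shows "H differentiable (at x)" "continuous_on UNIV (gradient H)"
proof -
  show H: "H differentiable (at x)" for x
    using assms by (simp add: numeral_3_eq_3)
  have "(\<lambda>x. frechet_derivative H (at x) b) differentiable (at x)" for b x
    using assms by (simp add: numeral_3_eq_3)
  then have "continuous_on UNIV (\<lambda>x. gradient H x \<bullet> b)" for b
    by (simp add: frechet_derivative_eq_inner_gradient[OF H] differentiable_imp_continuous_on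
        differentiable_on_def)
  then have "continuous_on UNIV (\<lambda>x. \<Sum>b\<in>Basis. (gradient H x \<bullet> b) *\<^sub>R b)"
    by (intro continuous_on_sum continuous_on_scaleR continuous_on_const)
  then show "continuous_on UNIV (gradient H)"
    by (simp add: euclidean_representation)
qed

text \<open>The component along \<open>v\<close> is the derivative of \<open>H\<close> in direction
  \<open>v\<close>, a scalar function of class C^2 to which the scalar Taylor bound applies. The
  basis components are reassembled at the price of summing their constants.\<close>

lemma gradient_taylor:
  fixes H :: "'a::euclidean_space \<Rightarrow> real"
  assumes "cont_diff 3 H"
  obtains A L where "taylor_on A L (cball z r) (gradient H)"
proof -
  have H: "\<And>x. H differentiable (at x)"
    using assms by (simp add: numeral_3_eq_3)
  have "cont_diff (Suc (Suc 0)) (\<lambda>x. frechet_derivative H (at x) v)" for v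
    using assms unfolding numeral_3_eq_3 cont_diff.simps(2)[of "Suc (Suc 0)"] by blast
  then have p: "cont_diff (Suc (Suc 0)) (\<lambda>x. gradient H x \<bullet> v)" for v
    by (simp only: frechet_derivative_eq_inner_gradient[OF H])
  have "\<exists>D l. taylor_on D l (cball z r) (\<lambda>x. gradient H x \<bullet> v)" for v
    using cont_diff_2_taylor[OF p[of v]] by blast
  then obtain D l where D: "\<And>v. taylor_on (D v) (l v) (cball z r) (\<lambda>x. gradient H x \<bullet> v)"
    by metis
  define A where "A a v = (\<Sum>b\<in>Basis. D b a v *\<^sub>R b)" for a v
  have Ab: "A a v \<bullet> b = D b a v" if "b \<in> Basis" for a v b
    using that by (simp add: A_def inner_sum_left inner_Basis if_distrib cong: if_cong)
  have "taylor_on A (\<Sum>b\<in>Basis. l b) (cball z r) (gradient H)"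
    unfolding taylor_on_def
  proof (intro conjI ballI allI)
    show "0 \<le> (\<Sum>b\<in>Basis. l b)"
      using D by (intro sum_nonneg) (simp add: taylor_on_def)
    fix a assume a: "a \<in> cball z r"
    have lin: "linear (D b a)" for b
      by (rule taylor_onD(2)[OF D a])
    show "linear (A a)"
      unfolding A_def using lin
      by (intro linear_compose_sum ballI linearI)
         (auto simp: linear_add[OF lin] linear_cmul[OF lin] scaleR_add_left)
    show "norm (A a v) \<le> (\<Sum>b\<in>Basis. l b) * norm v" for v
    proof -
      have "norm (A a v) \<le> (\<Sum>b\<in>Basis. \<bar>A a v \<bullet> b\<bar>)"
        by (rule norm_le_l1)
      also have "\<dots> \<le> (\<Sum>b\<in>Basis. l b * norm v)"
        by (rule sum_mono) (use taylor_onD(3)[OF D a, of _ v] Ab in simp)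
      finally show ?thesis
        by (simp add: sum_distrib_right)
    qed
    fix w assume w: "w \<in> cball z r"
    let ?u = "gradient H w - gradient H a - A a (w - a)"
    have "norm ?u \<le> (\<Sum>b\<in>Basis. \<bar>?u \<bullet> b\<bar>)"
      by (rule norm_le_l1)
    also have "\<dots> \<le> (\<Sum>b\<in>Basis. l b * (norm (w - a))\<^sup>2)"
      by (rule sum_mono) (use taylor_onD(4)[OF D a w] Ab in \<open>simp add: inner_diff_left\<close>)
    finally show "norm ?u \<le> (\<Sum>b\<in>Basis. l b) * (norm (w - a))\<^sup>2"
      by (simp add: sum_distrib_right)
  qed
  then show ?thesis
    using that by blast
qed

section \<open>Consequences of a uniform Taylor bound\<close>

lemma taylor_on_bounded_linear:
  assumes "bounded_linear T" "taylor_on A L X g"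
  obtains A' L' where "taylor_on A' L' X (\<lambda>x. T (g x))"
proof -
  interpret T: bounded_linear T by fact
  obtain K where K: "0 < K" "\<And>v. norm (T v) \<le> K * norm v"
    using T.pos_bounded by (auto simp: mult.commute)
  have KL: "norm (T v) \<le> K * L * s" if "norm v \<le> L * s" for v s
    using order_trans[OF K(2) mult_left_mono[OF that]] K(1) by (simp add: mult.assoc)
  have "taylor_on (\<lambda>a v. T (A a v)) (K * L) X (\<lambda>x. T (g x))"
    unfolding taylor_on_def
  proof (intro conjI ballI allI)
    fix a assume a: "a \<in> X"
    show "linear (\<lambda>v. T (A a v))"
      using linear_compose[OF taylor_onD(2)[OF assms(2) a] T.linear] by (simp add: o_def)
    show "norm (T (A a v)) \<le> K * L * norm v" for v
      by (rule KL) (rule taylor_onD(3)[OF assms(2) a])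
    fix w assume w: "w \<in> X"
    show "norm (T (g w) - T (g a) - T (A a (w - a))) \<le> K * L * (norm (w - a))\<^sup>2"
      using KL[OF taylor_onD(4)[OF assms(2) a w]] by (simp add: T.diff)
  qed (use K assms in \<open>simp add: taylor_on_def\<close>)
  then show ?thesis
    using that by blast
qed

text \<open>Two points of the ball are at most \<open>2 * r\<close> apart, so the quadratic
  remainder is absorbed into a linear bound. At radius 3 the factor \<open>1 + 2 * r\<close> is
  7.\<close>

lemma taylor_on_lipschitz:
  assumes "taylor_on A L (cball z r) g" "a \<in> cball z r" "w \<in> cball z r"
  shows "norm (g w - g a) \<le> L * (1 + 2 * r) * norm (w - a)"
proof -
  have "norm (w - a) \<le> 2 * r"
    using assms(2,3) norm_triangle_ineq4[of "w - z" "a - z"] by (simp add: dist_norm norm_minus_commute)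
  then have sq: "(norm (w - a))\<^sup>2 \<le> 2 * r * norm (w - a)"
    by (simp add: power2_eq_square mult_right_mono)
  have L: "0 \<le> L"
    by (rule taylor_onD(1)[OF assms(1,2)])
  have "norm (g w - g a) \<le> norm (g w - g a - A a (w - a)) + norm (A a (w - a))"
    by (metis diff_add_cancel norm_triangle_ineq)
  also have "\<dots> \<le> L * (norm (w - a))\<^sup>2 + L * norm (w - a)"
    by (intro add_mono taylor_onD[OF assms(1,2)] assms)
  also have "\<dots> \<le> L * (2 * r * norm (w - a)) + L * norm (w - a)"
    using sq L by (simp add: mult_left_mono)
  finally show ?thesis
    by (simp add: algebra_simps)
qed

text \<open>The linear terms \<open>A a d\<close> and \<open>A a (- d)\<close> cancel, which leaves
  two quadratic remainders.\<close>

lemma taylor_on_second_difference: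
  assumes "taylor_on A L X g" "a \<in> X" "a + d \<in> X" "a - d \<in> X"
  shows "norm (g (a + d) + g (a - d) - 2 *\<^sub>R g a) \<le> 2 * L * (norm d)\<^sup>2"
proof -
  note lin = taylor_onD(2)[OF assms(1,2)]
  have "g (a + d) + g (a - d) - 2 *\<^sub>R g a
      = (g (a + d) - g a - A a (a + d - a)) + (g (a - d) - g a - A a (a - d - a))"
    using linear_neg[OF lin, of d] by (simp add: scaleR_2)
  also have "norm \<dots> \<le> L * (norm (a + d - a))\<^sup>2 + L * (norm (a - d - a))\<^sup>2"
    by (intro norm_triangle_mono taylor_onD(4)[OF assms(1,2)] assms)
  finally show ?thesis
    by simp
qed

section \<open>Flow expansion and implicit one-step methods\<close>

text \<open>Each integration of an error gains one power. The mean value inequality gives the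
  constant \<open>C\<close> rather than the sharper \<open>C / (n + 1)\<close>, which is enough for
  O-estimates.\<close>

lemma norm_le_power_Suc:
  fixes e :: "real \<Rightarrow> 'a::real_normed_vector"
  assumes "\<And>s. \<bar>s\<bar> < \<delta> \<Longrightarrow> (e has_vector_derivative e' s) (at s)"
    and "\<And>s. \<bar>s\<bar> < \<delta> \<Longrightarrow> norm (e' s) \<le> C * \<bar>s\<bar> ^ n"
    and "e 0 = 0" "0 \<le> C" "\<bar>t\<bar> < \<delta>"
  shows "norm (e t) \<le> C * \<bar>t\<bar> ^ Suc n"
proof -
  have "norm (e t - e 0) \<le> (C * \<bar>t\<bar> ^ n) * norm (t - 0)"
  proof (rule differentiable_bound[OF convex_cball, of 0 "\<bar>t\<bar>" e "\<lambda>s x. x *\<^sub>R e' s"])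
    fix s :: real assume s: "s \<in> cball 0 \<bar>t\<bar>"
    then have s\<delta>: "\<bar>s\<bar> < \<delta>"
      using assms(5) by simp
    show "(e has_derivative (\<lambda>x. x *\<^sub>R e' s)) (at s within cball 0 \<bar>t\<bar>)"
      using assms(1)[OF s\<delta>] has_derivative_at_withinI unfolding has_vector_derivative_def by blast
    have "C * \<bar>s\<bar> ^ n \<le> C * \<bar>t\<bar> ^ n"
      using s assms(4) by (intro mult_left_mono power_mono) auto
    then show "onorm (\<lambda>x. x *\<^sub>R e' s) \<le> C * \<bar>t\<bar> ^ n"
      using assms(2)[OF s\<delta>] by (intro onorm_le) (simp add: mult.commute mult_left_mono)
  qed auto
  then show ?thesis
    by (simp add: assms(3) mult_ac)
qed

text \<open>A bootstrap in three rounds: boundedness of \<open>f\<close> along the solution gives an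
  O(t) displacement; inserting this into the Taylor estimate gives an O(t^2) error for the
  first-order expansion, and inserting that gives O(t^3) for the second-order one. No second
  derivative of \<phi> is formed.\<close>

lemma exact_solution_expansion:
  assumes ex: "exact_solution f z \<phi>"
    and A: "linear A" "\<And>v. norm (A v) \<le> L * norm v" "0 \<le> L"
    and T: "\<And>w. w \<in> cball z 1 \<Longrightarrow> norm (f w - f z - A (w - z)) \<le> L * (norm (w - z))\<^sup>2"
  obtains C \<delta> where "0 < \<delta>"
    "\<And>t. \<bar>t\<bar> < \<delta> \<Longrightarrow> norm (\<phi> t - z - t *\<^sub>R f z - (t\<^sup>2 / 2) *\<^sub>R A (f z)) \<le> C * \<bar>t\<bar> ^ 3"
proof -
  have \<phi>0: "\<phi> 0 = z" and ev: "\<forall>\<^sub>F t in nhds 0. (\<phi> has_vector_derivative f (\<phi> t)) (at t)"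
    using ex by (auto simp: exact_solution_def)
  have "continuous (at 0) \<phi>"
    using eventually_nhds_x_imp_x[OF ev] by (rule has_vector_derivative_continuous)
  then have "\<forall>\<^sub>F t in nhds 0. dist (\<phi> t) (\<phi> 0) < 1"
    by (intro tendstoD) (simp_all add: isCont_def tendsto_at_iff_tendsto_nhds)
  moreover have "\<forall>\<^sub>F t in nhds 0. dist t (0::real) < 1"
    by (auto simp: eventually_nhds_metric intro!: exI[of _ 1])
  ultimately have "\<forall>\<^sub>F t in nhds 0. (\<phi> has_vector_derivative f (\<phi> t)) (at t)
      \<and> dist (\<phi> t) z < 1 \<and> dist t 0 < 1"
    using ev by eventually_elim (simp add: \<phi>0)
  then obtain \<delta> where \<delta>: "0 < \<delta>"
    and d: "\<And>t. \<bar>t\<bar> < \<delta> \<Longrightarrow> (\<phi> has_vector_derivative f (\<phi> t)) (at t)"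
    and c: "\<And>t. \<bar>t\<bar> < \<delta> \<Longrightarrow> \<phi> t \<in> cball z 1"
    and t1: "\<And>t. \<bar>t\<bar> < \<delta> \<Longrightarrow> \<bar>t\<bar> \<le> 1"
    unfolding eventually_nhds_metric by (auto simp: dist_commute dist_real_def less_imp_le)
  \<comment> \<open>In the unit ball the increment of \<open>f\<close> is at most
    \<open>L + L\<close>, so \<open>M\<close> bounds \<open>f\<close> along the solution.\<close>
  define M where "M = norm (f z) + 2 * L"
  have M: "0 \<le> M"
    using A(3) by (simp add: M_def)
  have inc: "norm (f (\<phi> t) - f z) \<le> L * (norm (\<phi> t - z))\<^sup>2 + L * norm (\<phi> t - z)" if "\<bar>t\<bar> < \<delta>" for t
    using norm_triangle_ineq[of "f (\<phi> t) - f z - A (\<phi> t - z)" "A (\<phi> t - z)"] T[OF c[OF that]] A(2)[of "\<phi> t - z"]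
    by simp
  have fM: "norm (f (\<phi> t)) \<le> M" if "\<bar>t\<bar> < \<delta>" for t
  proof -
    have n: "norm (\<phi> t - z) \<le> 1"
      using c[OF that] by (simp add: dist_norm norm_minus_commute)
    then have "L * (norm (\<phi> t - z))\<^sup>2 \<le> L" "L * norm (\<phi> t - z) \<le> L"
      using A(3) by (auto intro!: mult_left_le simp: power_le_one)
    then show ?thesis
      using inc[OF that] norm_triangle_ineq[of "f (\<phi> t) - f z" "f z"] by (simp add: M_def)
  qed
  have d0: "((\<lambda>t. \<phi> t - z) has_vector_derivative f (\<phi> s)) (at s)" if "\<bar>s\<bar> < \<delta>" for s
    by (rule derivative_eq_intros d[OF that] refl | simp)+
  have d1: "((\<lambda>t. \<phi> t - z - t *\<^sub>R f z) has_vector_derivative f (\<phi> s) - f z) (at s)"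
    if "\<bar>s\<bar> < \<delta>" for s
    by (rule derivative_eq_intros d[OF that] refl | simp)+
  have d2: "((\<lambda>t. \<phi> t - z - t *\<^sub>R f z - (t\<^sup>2 / 2) *\<^sub>R A (f z)) has_vector_derivative
      f (\<phi> s) - f z - s *\<^sub>R A (f z)) (at s)" if "\<bar>s\<bar> < \<delta>" for s
    by (rule derivative_eq_intros d[OF that] refl | simp)+
  have e0: "norm (\<phi> t - z) \<le> M * \<bar>t\<bar>" if t: "\<bar>t\<bar> < \<delta>" for t
    using norm_le_power_Suc[of \<delta> "\<lambda>t. \<phi> t - z" "\<lambda>t. f (\<phi> t)" M 0 t, OF d0] fM M \<phi>0 t
    by simp
  have sq: "(norm (\<phi> t - z))\<^sup>2 \<le> M\<^sup>2 * \<bar>t\<bar>\<^sup>2" if "\<bar>t\<bar> < \<delta>" for t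
    using power_mono[OF e0[OF that], of 2] by (simp add: power_mult_distrib)
  define M2 where "M2 = L * M\<^sup>2 + L * M"
  have M2: "0 \<le> M2"
    using A(3) M by (simp add: M2_def)
  have incM: "norm (f (\<phi> t) - f z) \<le> M2 * \<bar>t\<bar>" if t: "\<bar>t\<bar> < \<delta>" for t
  proof -
    have "M\<^sup>2 * \<bar>t\<bar>\<^sup>2 \<le> M\<^sup>2 * \<bar>t\<bar>"
      using power_decreasing[of 1 2 "\<bar>t\<bar>"] t1[OF t] by (intro mult_left_mono) auto
    then have "L * (norm (\<phi> t - z))\<^sup>2 \<le> L * (M\<^sup>2 * \<bar>t\<bar>)"
      using sq[OF t] A(3) by (intro mult_left_mono) auto
    moreover have "L * norm (\<phi> t - z) \<le> L * (M * \<bar>t\<bar>)"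
      using e0[OF t] A(3) by (intro mult_left_mono) auto
    ultimately show ?thesis
      using inc[OF t] by (simp add: M2_def algebra_simps)
  qed
  have e1: "norm (\<phi> t - z - t *\<^sub>R f z) \<le> M2 * \<bar>t\<bar>\<^sup>2" if t: "\<bar>t\<bar> < \<delta>" for t
    using norm_le_power_Suc[of \<delta> "\<lambda>t. \<phi> t - z - t *\<^sub>R f z" "\<lambda>t. f (\<phi> t) - f z" M2 1 t, OF d1] incM M2 \<phi>0 t
    by (simp add: numeral_2_eq_2)
  define M3 where "M3 = L * M\<^sup>2 + L * M2"
  have M3: "0 \<le> M3"
    using A(3) M2 by (simp add: M3_def)
  have incA: "norm (f (\<phi> t) - f z - t *\<^sub>R A (f z)) \<le> M3 * \<bar>t\<bar>\<^sup>2" if t: "\<bar>t\<bar> < \<delta>" for t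
  proof -
    \<comment> \<open>The first bracket is the Taylor remainder of \<open>f\<close>; in the second,
      \<open>A\<close> acts on the first-order flow error, already known to be O(t^2).\<close>
    have "f (\<phi> t) - f z - t *\<^sub>R A (f z) = (f (\<phi> t) - f z - A (\<phi> t - z)) + A (\<phi> t - z - t *\<^sub>R f z)"
      using A(1) by (simp add: linear_diff linear_cmul)
    also have "norm \<dots> \<le> L * (M\<^sup>2 * \<bar>t\<bar>\<^sup>2) + L * (M2 * \<bar>t\<bar>\<^sup>2)"
    proof (rule norm_triangle_mono)
      show "norm (f (\<phi> t) - f z - A (\<phi> t - z)) \<le> L * (M\<^sup>2 * \<bar>t\<bar>\<^sup>2)"
        using T[OF c[OF t]] mult_left_mono[OF sq[OF t] A(3)] by linarith
      show "norm (A (\<phi> t - z - t *\<^sub>R f z)) \<le> L * (M2 * \<bar>t\<bar>\<^sup>2)"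
        using A(2)[of "\<phi> t - z - t *\<^sub>R f z"] mult_left_mono[OF e1[OF t] A(3)] by linarith
    qed
    finally show ?thesis
      by (simp add: M3_def algebra_simps)
  qed
  have "norm (\<phi> t - z - t *\<^sub>R f z - (t\<^sup>2 / 2) *\<^sub>R A (f z)) \<le> M3 * \<bar>t\<bar> ^ 3" if t: "\<bar>t\<bar> < \<delta>" for t
    using norm_le_power_Suc[of \<delta> "\<lambda>t. \<phi> t - z - t *\<^sub>R f z - (t\<^sup>2 / 2) *\<^sub>R A (f z)"
        "\<lambda>t. f (\<phi> t) - f z - t *\<^sub>R A (f z)" M3 2 t, OF d2] incA M3 \<phi>0 t
    by (simp add: numeral_3_eq_3 numeral_2_eq_2)
  with \<delta> show ?thesis
    using that by blast
qed

text \<open>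
  Both methods have the shape \<open>y = z + \<tau> f(m) + O(\<tau>\<^sup>3)\<close> of a midpoint rule: \<open>m\<close> is the intermediate
  value of the composition method, or \<open>(z + y) / 2\<close> for the averaged one.
\<close>

lemma order_two_via_midpoint:
  fixes f :: "'a::real_normed_vector \<Rightarrow> 'a"
  assumes ex: "exact_solution f z \<phi>"
    and T: "taylor_on A L (cball z 1) f"
    and m: "\<forall>\<^sub>F \<tau> in at 0. norm (m \<tau> - z - (\<tau> / 2) *\<^sub>R f z) \<le> K * \<bar>\<tau>\<bar>\<^sup>2"
    and y: "\<forall>\<^sub>F \<tau> in at 0. norm (y \<tau> - z - \<tau> *\<^sub>R f (m \<tau>)) \<le> K' * \<bar>\<tau>\<bar> ^ 3"
  shows "(\<lambda>\<tau>. norm (y \<tau> - \<phi> \<tau>)) \<in> O[at 0](\<lambda>\<tau>. \<tau> ^ 3)"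
proof -
  have z: "z \<in> cball z 1" by simp
  note Tz = taylor_onD[OF T z]
  obtain C \<delta> where \<delta>: "0 < \<delta>" and C: "\<And>t. \<bar>t\<bar> < \<delta> \<Longrightarrow>
      norm (\<phi> t - z - t *\<^sub>R f z - (t\<^sup>2 / 2) *\<^sub>R A z (f z)) \<le> C * \<bar>t\<bar> ^ 3"
    by (rule exact_solution_expansion[OF ex Tz(2) Tz(3) Tz(1) Tz(4)]) (assumption, rule that)
  \<comment> \<open>For \<open>\<bar>\<tau>\<bar> \<le> 1\<close> this gives
    \<open>norm (m \<tau> - z) \<le> K1 * \<bar>\<tau>\<bar>\<close>, and
    \<open>\<bar>\<tau>\<bar> < 1 / K1\<close> then keeps \<open>m \<tau>\<close> in the unit ball.
    The summand 1 makes \<open>K1\<close> positive.\<close>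
  define K1 where "K1 = norm (f z) + \<bar>K\<bar> + 1"
  have K1: "0 < K1"
    by (simp add: K1_def add_nonneg_pos)
  have "\<forall>\<^sub>F \<tau>::real in at 0. dist \<tau> 0 < min (min \<delta> 1) (1 / K1)"
    using \<delta> K1 unfolding eventually_at by (intro exI[of _ "min (min \<delta> 1) (1 / K1)"]) auto
  with m y have "\<forall>\<^sub>F \<tau> in at 0. norm (y \<tau> - \<phi> \<tau>) \<le> (K' + (L * K1\<^sup>2 + L * \<bar>K\<bar>) + C) * \<bar>\<tau>\<bar> ^ 3"
  proof eventually_elim
    case (elim \<tau>)
    then have \<tau>: "\<bar>\<tau>\<bar> < \<delta>" "\<bar>\<tau>\<bar> \<le> 1" "K1 * \<bar>\<tau>\<bar> \<le> 1"
      using K1 by (auto simp: field_simps)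
    have "norm (m \<tau> - z) \<le> norm (m \<tau> - z - (\<tau> / 2) *\<^sub>R f z) + norm ((\<tau> / 2) *\<^sub>R f z)"
      by (metis diff_add_cancel norm_triangle_ineq)
    also have "\<dots> \<le> \<bar>K\<bar> * \<bar>\<tau>\<bar> + norm (f z) * \<bar>\<tau>\<bar>"
    proof (rule add_mono)
      have "\<bar>\<tau>\<bar>\<^sup>2 \<le> \<bar>\<tau>\<bar>"
        using power_decreasing[of 1 2 "\<bar>\<tau>\<bar>"] \<tau>(2) by simp
      then have "K * \<bar>\<tau>\<bar>\<^sup>2 \<le> \<bar>K\<bar> * \<bar>\<tau>\<bar>"
        by (intro mult_mono) auto
      then show "norm (m \<tau> - z - (\<tau> / 2) *\<^sub>R f z) \<le> \<bar>K\<bar> * \<bar>\<tau>\<bar>"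
        using elim by linarith
      show "norm ((\<tau> / 2) *\<^sub>R f z) \<le> norm (f z) * \<bar>\<tau>\<bar>"
        by (simp add: mult.commute)
    qed
    also have "\<dots> \<le> K1 * \<bar>\<tau>\<bar>"
      by (simp add: K1_def algebra_simps)
    finally have mz: "norm (m \<tau> - z) \<le> K1 * \<bar>\<tau>\<bar>" .
    have mc: "m \<tau> \<in> cball z 1"
      using mz \<tau>(3) by (simp add: dist_norm norm_minus_commute)
    have "(norm (m \<tau> - z))\<^sup>2 \<le> K1\<^sup>2 * \<bar>\<tau>\<bar>\<^sup>2"
      using power_mono[OF mz, of 2] by (simp add: power_mult_distrib)
    then have r1: "norm (f (m \<tau>) - f z - A z (m \<tau> - z)) \<le> L * (K1\<^sup>2 * \<bar>\<tau>\<bar>\<^sup>2)"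
      using Tz(4)[OF mc] mult_left_mono[OF _ Tz(1)] by (meson order_trans)
    have "norm (m \<tau> - z - (\<tau> / 2) *\<^sub>R f z) \<le> \<bar>K\<bar> * \<bar>\<tau>\<bar>\<^sup>2"
      using elim(1) by (meson abs_ge_self mult_right_mono order_trans zero_le_power2)
    then have r2: "norm (A z (m \<tau> - z - (\<tau> / 2) *\<^sub>R f z)) \<le> L * (\<bar>K\<bar> * \<bar>\<tau>\<bar>\<^sup>2)"
      using Tz(3) mult_left_mono[OF _ Tz(1)] by (meson order_trans)
    have r3: "norm (\<tau> *\<^sub>R (f (m \<tau>) - f z - A z (m \<tau> - z) + A z (m \<tau> - z - (\<tau> / 2) *\<^sub>R f z)))
        \<le> \<bar>\<tau>\<bar> * (L * (K1\<^sup>2 * \<bar>\<tau>\<bar>\<^sup>2) + L * (\<bar>K\<bar> * \<bar>\<tau>\<bar>\<^sup>2))"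
      unfolding norm_scaleR real_norm_def
      by (intro mult_left_mono norm_triangle_mono r1 r2) auto
    have tri: "norm (p + q - r) \<le> norm p + norm q + norm r" for p q r :: 'a
      using norm_triangle_ineq4[of "p + q" r] norm_triangle_ineq[of p q] by linarith
    \<comment> \<open>The flow's second-order term is matched because \<tau> times
      \<open>A z\<close> applied to \<open>(\<tau> / 2) *\<^sub>R f z\<close> equals
      \<open>(\<tau>\<^sup>2 / 2) *\<^sub>R A z (f z)\<close>.\<close>
    have "y \<tau> - \<phi> \<tau> = (y \<tau> - z - \<tau> *\<^sub>R f (m \<tau>))
        + \<tau> *\<^sub>R (f (m \<tau>) - f z - A z (m \<tau> - z) + A z (m \<tau> - z - (\<tau> / 2) *\<^sub>R f z))
        - (\<phi> \<tau> - z - \<tau> *\<^sub>R f z - (\<tau>\<^sup>2 / 2) *\<^sub>R A z (f z))"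
      using Tz(2) by (simp add: linear_diff linear_add linear_cmul algebra_simps power2_eq_square)
    then have "norm (y \<tau> - \<phi> \<tau>) \<le> (norm (y \<tau> - z - \<tau> *\<^sub>R f (m \<tau>))
        + norm (\<tau> *\<^sub>R (f (m \<tau>) - f z - A z (m \<tau> - z) + A z (m \<tau> - z - (\<tau> / 2) *\<^sub>R f z))))
        + norm (\<phi> \<tau> - z - \<tau> *\<^sub>R f z - (\<tau>\<^sup>2 / 2) *\<^sub>R A z (f z))"
      by (simp only: tri)
    also have "\<dots> \<le> (K' * \<bar>\<tau>\<bar> ^ 3 + \<bar>\<tau>\<bar> * (L * (K1\<^sup>2 * \<bar>\<tau>\<bar>\<^sup>2) + L * (\<bar>K\<bar> * \<bar>\<tau>\<bar>\<^sup>2))) + C * \<bar>\<tau>\<bar> ^ 3"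
      by (intro add_mono elim(2) r3 C \<tau>(1))
    finally show ?case
      by (simp add: algebra_simps power2_eq_square power3_eq_cube)
  qed
  then show ?thesis
    by (intro bigoI[where c = "K' + (L * K1\<^sup>2 + L * \<bar>K\<bar>) + C"]) (simp add: power_abs)
qed

text \<open>
  Brouwer's theorem gives a solution near \<open>a\<close> and compactness a nearest one, so no uniqueness is
  needed to control the \<open>arg_min\<close>.
\<close>

lemma close_solution_near:
  fixes F :: "'a::euclidean_space \<Rightarrow> 'a \<Rightarrow> 'a"
  assumes F: "continuous_on UNIV (\<lambda>(a, b). F a b)"
    and R: "\<And>\<tau> a b. \<tau> \<noteq> 0 \<Longrightarrow> R \<tau> a b \<longleftrightarrow> b - a = \<tau> *\<^sub>R F a b"
  obtains \<tau>\<^sub>0 K where "0 < \<tau>\<^sub>0" "0 < K"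
    "\<And>\<tau> a. \<tau> \<noteq> 0 \<Longrightarrow> \<bar>\<tau>\<bar> < \<tau>\<^sub>0 \<Longrightarrow> a \<in> cball z 1 \<Longrightarrow>
       R \<tau> a (close_solution R \<tau> a) \<and> norm (close_solution R \<tau> a - a) \<le> K * \<bar>\<tau>\<bar>"
proof -
  have "bounded ((\<lambda>(a, b). F a b) ` (cball z 1 \<times> cball z 2))"
    by (intro compact_imp_bounded compact_continuous_image continuous_on_subset[OF F] compact_Times) auto
  then obtain K where K: "0 < K" and FK: "\<And>a b. a \<in> cball z 1 \<Longrightarrow> b \<in> cball z 2 \<Longrightarrow> norm (F a b) \<le> K"
    unfolding bounded_pos by (metis (no_types, lifting) SigmaI case_prod_conv image_eqI)
  have Fa: "continuous_on UNIV (F a)" for a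
    using continuous_on_compose2[OF F continuous_on_Pair[OF continuous_on_const[of UNIV a] continuous_on_id]] by simp
  \<comment> \<open>\<open>K\<close> bounds \<open>F\<close> for second arguments in
    \<open>cball z 2\<close>, which contains every unit ball about \<open>a\<close>; below
    \<open>1 / K\<close> the fixed point map therefore sends \<open>cball a 1\<close> into itself.
    Uniformity in \<open>a\<close> lets a second half-step start from a point that depends on
    \<tau>.\<close>
  have "R \<tau> a (close_solution R \<tau> a) \<and> norm (close_solution R \<tau> a - a) \<le> K * \<bar>\<tau>\<bar>"
    if \<tau>: "\<tau> \<noteq> 0" "\<bar>\<tau>\<bar> < 1 / K" and a: "a \<in> cball z 1" for \<tau> a
  proof -
    have K\<tau>: "K * \<bar>\<tau>\<bar> \<le> 1"
      using \<tau>(2) K by (simp add: field_simps)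
    have sub: "b \<in> cball z 2" if "b \<in> cball a 1" for b
      using that a dist_triangle[of z b a] by simp
    obtain b where b: "b \<in> cball a 1" "a + \<tau> *\<^sub>R F a b = b"
    proof (rule brouwer[of "cball a 1" "\<lambda>b. a + \<tau> *\<^sub>R F a b"])
      show "continuous_on (cball a 1) (\<lambda>b. a + \<tau> *\<^sub>R F a b)"
        by (intro continuous_intros continuous_on_subset[OF Fa]) auto
      show "(\<lambda>b. a + \<tau> *\<^sub>R F a b) \<in> cball a 1 \<rightarrow> cball a 1"
      proof
        fix b assume "b \<in> cball a 1"
        then have "\<bar>\<tau>\<bar> * norm (F a b) \<le> \<bar>\<tau>\<bar> * K"
          by (intro mult_left_mono FK[OF a sub]) auto
        then show "a + \<tau> *\<^sub>R F a b \<in> cball a 1"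
          using K\<tau> by (simp add: dist_norm mult.commute)
      qed
    qed auto
    define X where "X = {b \<in> cball a 1. b - a - \<tau> *\<^sub>R F a b = 0}"
    have "closed X"
      unfolding X_def
      by (intro continuous_closed_preimage_constant continuous_intros continuous_on_subset[OF Fa]) auto
    then have "compact X"
      using compact_Int_closed[OF compact_cball, of X a 1] by (simp add: X_def Int_def conj_commute)
    moreover have bX: "b \<in> X"
      using b by (auto simp: X_def algebra_simps)
    ultimately obtain c where c: "c \<in> X" "\<And>x. x \<in> X \<Longrightarrow> dist a c \<le> dist a x"
      using distance_attains_inf[of X a] compact_imp_closed by (metis empty_iff)
    have iff: "x \<in> X \<longleftrightarrow> R \<tau> a x \<and> x \<in> cball a 1" for x
      using R[OF \<tau>(1)] by (auto simp: X_def algebra_simps)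
    \<comment> \<open>A solution outside \<open>cball a 1\<close> is farther from \<open>a\<close>
      than 1, hence farther than \<open>c\<close>, so the minimizer over \<open>X\<close> is a
      global one.\<close>
    have "is_arg_min (dist a) (R \<tau> a) c"
      using c iff unfolding is_arg_min_def by (metis dual_order.strict_trans2 less_imp_le mem_cball not_le)
    then have m: "is_arg_min (dist a) (R \<tau> a) (close_solution R \<tau> a)"
      unfolding close_solution_def arg_min_def by (rule someI)
    let ?s = "close_solution R \<tau> a"
    have Rs: "R \<tau> a ?s" and "dist a ?s \<le> dist a c"
      using m c(1) iff by (auto simp: is_arg_min_def not_less)
    then have s: "?s \<in> cball a 1"
      using c(1) iff by (meson mem_cball order_trans)
    \<comment> \<open>Once the selected solution is known to lie in the unit ball, its own equation
      sharpens the distance from 1 to a multiple of \<open>\<bar>\<tau>\<bar>\<close>.\<close>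
    have "norm (?s - a) = \<bar>\<tau>\<bar> * norm (F a ?s)"
      using Rs R[OF \<tau>(1)] by simp
    also have "\<dots> \<le> \<bar>\<tau>\<bar> * K"
      by (intro mult_left_mono FK[OF a sub[OF s]]) auto
    finally show ?thesis
      using Rs by (simp add: mult.commute)
  qed
  then show ?thesis
    using that[of "1 / K" K] K by auto
qed

section \<open>The partitioned discrete gradient and energy conservation\<close>

text \<open>
  The integration path of the \<open>k\<close>-th block of \<open>pavf_gradient H a b\<close> is
  \<open>\<xi> \<mapsto> a + path_mask k \<xi> (b - a)\<close>.
\<close>

definition path_mask :: "'m::{finite,linorder} \<Rightarrow> real \<Rightarrow> ('d::finite, 'm) blocks \<Rightarrow> ('d, 'm) blocks" where
  "path_mask k \<xi> v = (\<chi> j. if j < k then v $ j else if j = k then \<xi> *\<^sub>R v $ j else 0)"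

lemma path_mask_diff: "path_mask k \<xi> (u - v) = path_mask k \<xi> u - path_mask k \<xi> v"
  by (simp add: path_mask_def vec_eq_iff scaleR_diff_right)

lemma path_mask_zero [simp]: "path_mask k \<xi> 0 = 0"
  by (simp add: path_mask_def vec_eq_iff)

lemma norm_path_mask_le:
  assumes "\<xi> \<in> {0..1}"
  shows "norm (path_mask k \<xi> v) \<le> norm v"
  by (rule norm_le_componentwise_cart)
     (use assms in \<open>auto simp: path_mask_def intro!: mult_left_le_one_le\<close>)

text \<open>Blockwise the complementary mask multiplies by 0, \<open>1 - \<xi>\<close> or 1. It
  measures what remains between a path point and the end of the path.\<close>

lemma norm_diff_path_mask_le:
  assumes "\<xi> \<in> {0..1}"
  shows "norm (v - path_mask k \<xi> v) \<le> norm v"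
proof (rule norm_le_componentwise_cart)
  fix j
  have "norm (v $ k - \<xi> *\<^sub>R v $ k) = (1 - \<xi>) * norm (v $ k)"
    using assms norm_scaleR[of "1 - \<xi>" "v $ k"] by (simp add: scaleR_diff_left)
  also have "\<dots> \<le> norm (v $ k)"
    using assms by (intro mult_left_le_one_le) auto
  finally show "norm ((v - path_mask k \<xi> v) $ j) \<le> norm (v $ j)"
    by (auto simp: path_mask_def)
qed

lemma continuous_on_path_mask [continuous_intros]:
  assumes "continuous_on X c" "continuous_on X v"
  shows "continuous_on X (\<lambda>x. path_mask k (c x) (v x))"
  unfolding path_mask_def
proof (rule continuous_on_vec_lambda)
  fix j
  show "continuous_on X (\<lambda>x. if j < k then v x $ j else if j = k then c x *\<^sub>R v x $ j else 0)"
    by (cases "j < k"; cases "j = k") (auto intro!: continuous_intros assms)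
qed

text \<open>Replacing block \<open>k\<close> is the affine map adding \<open>axis k w\<close> to the
  state \<open>c\<close> whose block \<open>k\<close> is zero. By the chain rule the adjoint of
  \<open>axis k\<close>, projection to block \<open>k\<close>, is applied to the full
  gradient.\<close>

lemma block_gradient_eq:
  fixes H :: "('d::finite, 'm::finite) blocks \<Rightarrow> real"
  assumes "\<And>z. H differentiable (at z)"
  shows "block_gradient H k z = gradient H z $ k"
  unfolding block_gradient_def
proof (rule gradient_eqI)
  define c where "c = (\<chi> j. if j = k then 0 else z $ j)"
  have eq: "(\<chi> j. if j = k then w else z $ j) = c + axis k w" for w
    by (simp add: c_def axis_def vec_eq_iff)
  have z: "c + axis k (z $ k) = z"
    by (simp add: c_def axis_def vec_eq_iff)
  have "bounded_linear (axis k :: real ^ 'd \<Rightarrow> ('d, 'm) blocks)"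
    by (intro linear_conv_bounded_linear[THEN iffD1] linearI) (auto simp: axis_def vec_eq_iff)
  then have ax: "((\<lambda>w. c + axis k w) has_derivative axis k) (at (z $ k))"
    by (auto intro!: derivative_eq_intros bounded_linear_imp_has_derivative)
  have "(H has_derivative (\<lambda>h. h \<bullet> gradient H z)) (at (c + axis k (z $ k)))"
    using GDERIV_gradient[OF assms, of z] by (simp add: z gderiv_def)
  from has_derivative_compose[OF ax this]
  show "GDERIV (\<lambda>w. H (\<chi> j. if j = k then w else z $ j)) (z $ k) :> gradient H z $ k"
    by (simp add: gderiv_def eq inner_commute[of "axis _ _"] inner_axis inner_commute[of _ "gradient H z $ k"])
qed

lemma pavf_gradient_eq:
  assumes "\<And>z. H differentiable (at z)"
  shows "pavf_gradient H a b
    = (\<chi> k. integral {0..1} (\<lambda>\<xi>. gradient H (a + path_mask k \<xi> (b - a)) $ k))"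
proof -
  have "(\<chi> j. if j < k then b $ j else if j = k then \<xi> *\<^sub>R b $ k + (1 - \<xi>) *\<^sub>R a $ k else a $ j)
      = a + path_mask k \<xi> (b - a)" for k \<xi>
    by (auto simp: path_mask_def vec_eq_iff algebra_simps)
  then show ?thesis
    by (simp add: pavf_gradient_def block_gradient_eq[OF assms])
qed

lemma integral_reflect_unit_interval:
  fixes f :: "real \<Rightarrow> 'a::euclidean_space"
  assumes "f integrable_on {0..1}"
  shows "integral {0..1} (\<lambda>\<xi>. f (1 - \<xi>)) = integral {0..1} f"
proof -
  have im: "(\<lambda>x::real. 1 - x) ` {0..1} = {0..1}"
  proof (intro equalityI subsetI)
    fix x :: real assume "x \<in> {0..1}"
    then show "x \<in> (\<lambda>x. 1 - x) ` {0..1}"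
      by (intro image_eqI[of _ _ "1 - x"]) auto
  qed auto
  have "(f has_integral integral {0..1} f) (cbox 0 1)"
    using assms by (simp add: integrable_integral)
  from has_integral_affinity[OF this, of "-1" 1] im show ?thesis
    by (simp add: integral_unique)
qed

lemma continuous_on_gradient_path:
  fixes H :: "('d::finite, 'm::{finite,linorder}) blocks \<Rightarrow> real"
  assumes "continuous_on UNIV (gradient H)"
  shows "continuous_on X (\<lambda>\<xi>. gradient H (a + path_mask k \<xi> v) $ k)"
  by (intro continuous_intros continuous_on_compose2[OF assms]) auto

text \<open>The adjoint path at \<xi> is the path from \<open>b\<close> to \<open>a\<close> at
  \<open>1 - \<xi>\<close>: blocks below \<open>k\<close> come from \<open>a\<close>, those above
  from \<open>b\<close>. Reflecting the unit interval then removes the reversal of the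
  parameter.\<close>

lemma pavf_adj_gradient_eq:
  fixes H :: "('d::finite, 'm::{finite,linorder}) blocks \<Rightarrow> real"
  assumes "\<And>z. H differentiable (at z)" "continuous_on UNIV (gradient H)"
  shows "pavf_adj_gradient H a b = pavf_gradient H b a"
proof -
  have "(\<chi> j. if j < k then a $ j else if j = k then \<xi> *\<^sub>R b $ k + (1 - \<xi>) *\<^sub>R a $ k else b $ j)
      = b + path_mask k (1 - \<xi>) (a - b)" for k \<xi>
    by (auto simp: path_mask_def vec_eq_iff algebra_simps)
  then have "pavf_adj_gradient H a b
      = (\<chi> k. integral {0..1} (\<lambda>\<xi>. gradient H (b + path_mask k (1 - \<xi>) (a - b)) $ k))"
    by (simp add: pavf_adj_gradient_def block_gradient_eq[OF assms(1)])
  then show ?thesis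
    by (simp add: pavf_gradient_eq[OF assms(1)] vec_eq_iff
        integral_reflect_unit_interval[OF integrable_continuous_interval[OF continuous_on_gradient_path[OF assms(2)]]])
qed

text \<open>Joint continuity provides both the bound on compact products and the continuity in the
  unknown that the fixed point argument for the implicit steps uses.\<close>

lemma continuous_on_pavf_gradient:
  fixes H :: "('d::finite, 'm::{finite,linorder}) blocks \<Rightarrow> real"
  assumes "\<And>z. H differentiable (at z)" "continuous_on UNIV (gradient H)"
  shows "continuous_on UNIV (\<lambda>(a, b). pavf_gradient H a b)"
  unfolding pavf_gradient_eq[OF assms(1)] case_prod_beta
proof (rule continuous_on_vec_lambda)
  fix k :: 'm
  have "continuous_on (UNIV \<times> cbox 0 1)
      (\<lambda>(p, \<xi>). gradient H (fst p + path_mask k \<xi> (snd p - fst p)) $ k)"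
    unfolding case_prod_beta
    by (intro continuous_intros continuous_on_compose2[OF assms(2)]) auto
  from integral_continuous_on_param[OF this]
  show "continuous_on UNIV (\<lambda>p. integral {0..1} (\<lambda>\<xi>. gradient H (fst p + path_mask k \<xi> (snd p - fst p)) $ k))"
    by simp
qed

lemma pavf_gradient_same:
  assumes "\<And>z. H differentiable (at z)"
  shows "pavf_gradient H a a = gradient H a"
  by (simp add: pavf_gradient_eq[OF assms] vec_eq_iff)

lemma pavf_gradient_inner_diff:
  fixes H :: "('d::finite, 'm::{finite,linorder}) blocks \<Rightarrow> real"
  assumes "\<And>z. H differentiable (at z)" "continuous_on UNIV (gradient H)"
  shows "pavf_gradient H a b \<bullet> (b - a) = H b - H a"
proof -
  \<comment> \<open>Switching the blocks from \<open>a\<close> to \<open>b\<close> one at a time, in increasing order, makes the sum telescope.\<close>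
  define u where "u A = (\<chi> j. if j \<in> A then b $ j else a $ j)" for A
  \<comment> \<open>Restricting to down-closed sets forces \<open>A\<close> to be
    \<open>{..<k}\<close> when the maximal element \<open>k\<close> is inserted, so the path of
    block \<open>k\<close> runs exactly from \<open>u A\<close> to
    \<open>u (insert k A)\<close>.\<close>
  have "(\<forall>k\<in>A. \<forall>j<k. j \<in> A) \<longrightarrow>
      (\<Sum>k\<in>A. pavf_gradient H a b $ k \<bullet> (b - a) $ k) = H (u A) - H a" for A
    using finite[of A]
  proof (induction A rule: finite_linorder_max_induct)
    case empty
    then show ?case by (simp add: u_def)
  next
    case (insert k A)
    show ?case
    proof
      assume down: "\<forall>i\<in>insert k A. \<forall>j<i. j \<in> insert k A"
      have A: "A = {..<k}"
        using insert.hyps(2) down by auto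
      let ?p = "\<lambda>\<xi>. a + path_mask k \<xi> (b - a)"
      have p: "?p \<xi> = u A + axis k (\<xi> *\<^sub>R (b - a) $ k)" for \<xi>
        by (auto simp: A u_def path_mask_def axis_def vec_eq_iff)
      have p0: "?p 0 = u A"
        by (simp add: p axis_def vec_eq_iff)
      have p1: "?p 1 = u (insert k A)"
        by (auto simp: A u_def path_mask_def vec_eq_iff)
      have "((\<lambda>\<xi>. H (?p \<xi>)) has_vector_derivative gradient H (?p \<xi>) $ k \<bullet> (b - a) $ k) (at \<xi> within X)" for \<xi> X
      proof -
        have "bounded_linear (\<lambda>\<xi>. axis k (\<xi> *\<^sub>R (b - a) $ k))"
          by (intro linear_conv_bounded_linear[THEN iffD1] linearI)
             (auto simp: axis_def vec_eq_iff algebra_simps)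
        then have "(?p has_derivative (\<lambda>\<xi>. axis k (\<xi> *\<^sub>R (b - a) $ k))) (at \<xi> within X)"
          unfolding p by (auto intro!: derivative_eq_intros bounded_linear_imp_has_derivative)
        moreover have "(H has_derivative (\<lambda>h. h \<bullet> gradient H (?p \<xi>))) (at (?p \<xi>))"
          using GDERIV_gradient[OF assms(1)] by (simp add: gderiv_def)
        ultimately show ?thesis
          unfolding has_vector_derivative_def
          by (rule has_derivative_eq_rhs[OF has_derivative_compose])
             (auto simp: inner_commute[of "axis _ _"] inner_axis)
      qed
      then have i1: "((\<lambda>\<xi>. gradient H (?p \<xi>) $ k \<bullet> (b - a) $ k) has_integral H (?p 1) - H (?p 0)) {0..1}"
        by (intro fundamental_theorem_of_calculus) auto
      have i2: "((\<lambda>\<xi>. gradient H (?p \<xi>) $ k \<bullet> (b - a) $ k) has_integral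
          integral {0..1} (\<lambda>\<xi>. gradient H (?p \<xi>) $ k) \<bullet> (b - a) $ k) {0..1}"
        using has_integral_linear[OF integrable_integral[OF
              integrable_continuous_interval[OF continuous_on_gradient_path[OF assms(2)]]]
            bounded_linear_inner_left[of "(b - a) $ k"]]
        by (simp add: o_def)
      have step: "pavf_gradient H a b $ k \<bullet> (b - a) $ k = H (u (insert k A)) - H (u A)"
        using has_integral_unique[OF i2 i1] by (simp add: pavf_gradient_eq[OF assms(1)] p0 p1)
      have "k \<notin> A"
        using insert.hyps(2) by auto
      moreover have "(\<Sum>k\<in>A. pavf_gradient H a b $ k \<bullet> (b - a) $ k) = H (u A) - H a"
        using insert.IH by (auto simp: A)
      ultimately show "(\<Sum>k\<in>insert k A. pavf_gradient H a b $ k \<bullet> (b - a) $ k) = H (u (insert k A)) - H a"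
        using insert.hyps(1) step by simp
    qed
  qed
  from this[of UNIV] show ?thesis
    by (simp add: inner_vec_def u_def)
qed

section \<open>The block action of the skew matrix and the energy law\<close>

lemma linear_block_mult: "linear (block_mult S)"
  by (rule linearI)
     (simp_all add: block_mult_def unflatten_def flatten_def matrix_vector_mult_def vec_eq_iff
        algebra_simps sum.distrib sum_distrib_left)

lemma bounded_linear_block_mult: "bounded_linear (block_mult S)"
  using linear_block_mult linear_conv_bounded_linear by blast

lemma inner_block_mult: "u \<bullet> block_mult S v = flatten u \<bullet> (S *v flatten v)"
  by (simp add: inner_vec_def block_mult_def unflatten_def flatten_def sum.cartesian_product case_prod_beta)

lemma skew_inner_block_mult:
  assumes "transpose S = - S"
  shows "v \<bullet> block_mult S v = 0"
proof -
  let ?x = "flatten v"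
  have "?x \<bullet> (S *v ?x) = (transpose S *v ?x) \<bullet> ?x"
    by (simp add: dot_lmul_matrix)
  also have "\<dots> = - (?x \<bullet> (S *v ?x))"
    by (simp add: assms inner_commute matrix_vector_mult_def inner_vec_def sum_negf)
  finally show ?thesis
    by (simp add: inner_block_mult)
qed

lemma divide_scaleR_eq_iff:
  fixes v w :: "'a::real_vector"
  assumes "\<tau> \<noteq> 0"
  shows "(1 / \<tau>) *\<^sub>R v = w \<longleftrightarrow> v = \<tau> *\<^sub>R w"
  using assms by auto

lemma pavf_step_iff:
  assumes "\<tau> \<noteq> 0"
  shows "pavf_step S H \<tau> a b \<longleftrightarrow> b - a = \<tau> *\<^sub>R block_mult S (pavf_gradient H a b)"
  by (simp add: pavf_step_def divide_scaleR_eq_iff[OF assms])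

lemma pavf_adj_step_iff:
  assumes "\<tau> \<noteq> 0" "\<And>z. H differentiable (at z)" "continuous_on UNIV (gradient H)"
  shows "pavf_adj_step S H \<tau> a b \<longleftrightarrow> b - a = \<tau> *\<^sub>R block_mult S (pavf_gradient H b a)"
  by (simp add: pavf_adj_step_def divide_scaleR_eq_iff[OF assms(1)] pavf_adj_gradient_eq[OF assms(2,3)])

lemma pavf_p_step_iff:
  assumes "\<tau> \<noteq> 0" "\<And>z. H differentiable (at z)" "continuous_on UNIV (gradient H)"
  shows "pavf_p_step S H \<tau> a b \<longleftrightarrow>
    b - a = \<tau> *\<^sub>R (1 / 2) *\<^sub>R block_mult S (pavf_gradient H a b + pavf_gradient H b a)"
  by (simp add: pavf_p_step_def divide_scaleR_eq_iff[OF assms(1)] pavf_adj_gradient_eq[OF assms(2,3)])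

text \<open>The increment is a multiple of \<open>block_mult S\<close> applied to the discrete
  gradient, and skewness makes it orthogonal to that gradient. Stating the step as an equation in an
  arbitrary real \<tau> also covers backward steps.\<close>

lemma pavf_step_energy:
  assumes "transpose S = - S" "\<And>z. H differentiable (at z)" "continuous_on UNIV (gradient H)"
    and "b - a = \<tau> *\<^sub>R block_mult S (pavf_gradient H a b)"
  shows "H b = H a"
  using pavf_gradient_inner_diff[OF assms(2,3), of a b] skew_inner_block_mult[OF assms(1)]
  by (simp add: assms(4))

lemma pavf_c_step_energy:
  assumes "transpose S = - S" "\<And>z. H differentiable (at z)" "continuous_on UNIV (gradient H)"
    and "\<tau> \<noteq> 0" "pavf_c_step S H \<tau> a b"
  shows "H b = H a"
proof -
  obtain c where ac: "c - a = (\<tau> / 2) *\<^sub>R block_mult S (pavf_gradient H a c)"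
    and "b - c = (\<tau> / 2) *\<^sub>R block_mult S (pavf_gradient H b c)"
    using assms(4,5) pavf_step_iff[of "\<tau> / 2" S H] pavf_adj_step_iff[OF _ assms(2,3), of "\<tau> / 2" S]
    by (auto simp: pavf_c_step_def)
  \<comment> \<open>The adjoint half-step from \<open>c\<close> to \<open>b\<close>, read backwards,
    is an ordinary step from \<open>b\<close> to \<open>c\<close> with time step
    \<open>- (\<tau> / 2)\<close>.\<close>
  then have "c - b = (- (\<tau> / 2)) *\<^sub>R block_mult S (pavf_gradient H b c)"
    by (metis minus_diff_eq scaleR_minus_left)
  then show ?thesis
    using pavf_step_energy[OF assms(1-3) ac] pavf_step_energy[OF assms(1-3)] by metis
qed

lemma pavf_p_step_energy:
  assumes "transpose S = - S" "\<And>z. H differentiable (at z)" "continuous_on UNIV (gradient H)"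
    and "\<tau> \<noteq> 0" "pavf_p_step S H \<tau> a b"
  shows "H b = H a"
proof -
  let ?g = "pavf_gradient H a b + pavf_gradient H b a"
  have ba: "b - a = \<tau> *\<^sub>R (1 / 2) *\<^sub>R block_mult S ?g"
    using assms pavf_p_step_iff by blast
  \<comment> \<open>Neither discrete gradient alone has to be orthogonal to \<open>b - a\<close>;
    their sum is, and adding the two energy identities gives twice the energy difference.\<close>
  have "2 * (H b - H a) = pavf_gradient H a b \<bullet> (b - a) - pavf_gradient H b a \<bullet> (a - b)"
    by (simp add: pavf_gradient_inner_diff[OF assms(2,3)])
  also have "\<dots> = ?g \<bullet> (b - a)"
    by (simp add: algebra_simps inner_add_left inner_diff_right)
  also have "\<dots> = 0"
    unfolding ba by (simp add: skew_inner_block_mult[OF assms(1)])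
  finally show ?thesis by simp
qed

section \<open>Order two\<close>

text \<open>Evaluating both paths at the same \<open>k\<close> and \<xi> lets cancellation take
  place under the integral sign. The sign \<open>s\<close> covers differences and sums;
  \<open>CARD('m)\<close> comes from bounding the norm by the sum of the block norms.\<close>

lemma norm_pavf_gradient_combination_le:
  fixes H :: "('d::finite, 'm::{finite,linorder}) blocks \<Rightarrow> real"
  assumes "\<And>z. H differentiable (at z)" "continuous_on UNIV (gradient H)"
    and B: "\<And>k \<xi>. \<xi> \<in> {0..1} \<Longrightarrow> norm (gradient H (a + path_mask k \<xi> (b - a))
      + s *\<^sub>R gradient H (a' + path_mask k \<xi> (b' - a')) - c) \<le> B"
  shows "norm (pavf_gradient H a b + s *\<^sub>R pavf_gradient H a' b' - c) \<le> real CARD('m) * B"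
proof -
  let ?h = "\<lambda>k \<xi>. gradient H (a + path_mask k \<xi> (b - a)) $ k
      + s *\<^sub>R gradient H (a' + path_mask k \<xi> (b' - a')) $ k - c $ k"
  have cont: "continuous_on {0..1} (?h k)" for k
    by (intro continuous_intros continuous_on_gradient_path[OF assms(2)])
  have comp: "(pavf_gradient H a b + s *\<^sub>R pavf_gradient H a' b' - c) $ k = integral {0..1} (?h k)" for k
  proof -
    note int = integrable_continuous_interval[OF continuous_on_gradient_path[OF assms(2)]]
    have "((\<lambda>\<xi>::real. c $ k) has_integral c $ k) {0..1}"
      using has_integral_const_real[of "c $ k" 0 1] by simp
    then have "(?h k has_integral
        integral {0..1} (\<lambda>\<xi>. gradient H (a + path_mask k \<xi> (b - a)) $ k)
        + s *\<^sub>R integral {0..1} (\<lambda>\<xi>. gradient H (a' + path_mask k \<xi> (b' - a')) $ k) - c $ k) {0..1}"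
      by (intro has_integral_diff has_integral_add has_integral_cmul integrable_integral int)
    from integral_unique[OF this] show ?thesis
      by (simp add: pavf_gradient_eq[OF assms(1)])
  qed
  have "norm (integral {0..1} (?h k)) \<le> B" for k
  proof -
    have "norm (?h k \<xi>) \<le> B" if "\<xi> \<in> {0..1}" for \<xi>
      using Finite_Cartesian_Product.norm_nth_le[of "gradient H (a + path_mask k \<xi> (b - a))
        + s *\<^sub>R gradient H (a' + path_mask k \<xi> (b' - a')) - c" k] B[OF that, of k] by simp
    then show ?thesis
      using integral_bound[OF _ cont[of k], of B] by simp
  qed
  then have le: "norm ((pavf_gradient H a b + s *\<^sub>R pavf_gradient H a' b' - c) $ k) \<le> B" for k
    by (simp only: comp)
  let ?v = "pavf_gradient H a b + s *\<^sub>R pavf_gradient H a' b' - c"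
  have "norm ?v \<le> (\<Sum>k\<in>UNIV. norm (?v $ k))"
    unfolding norm_vec_def by (rule L2_set_le_sum) simp
  also have "\<dots> \<le> (\<Sum>k\<in>(UNIV::'m set). B)"
    by (rule sum_mono) (rule le)
  finally show ?thesis
    by simp
qed

text \<open>The crude triangle bound 1 + (1 + 1) explains why Taylor estimates are taken on a ball
  of radius 3.\<close>

lemma path_in_cball:
  assumes "a \<in> cball z 1" "b \<in> cball z 1" "\<xi> \<in> {0..1}"
  shows "a + path_mask k \<xi> (b - a) \<in> cball z 3"
proof -
  have "norm (a + path_mask k \<xi> (b - a) - z) \<le> norm (a - z) + norm (path_mask k \<xi> (b - a))"
    using norm_triangle_ineq[of "a - z" "path_mask k \<xi> (b - a)"] by (simp add: algebra_simps)
  also have "\<dots> \<le> norm (a - z) + (norm (b - z) + norm (a - z))"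
    using norm_path_mask_le[OF assms(3), of k "b - a"] norm_triangle_ineq4[of "b - z" "a - z"]
    by simp
  also have "\<dots> \<le> 3"
    using assms(1,2) by (simp add: dist_norm norm_minus_commute)
  finally show ?thesis
    by (simp add: dist_norm norm_minus_commute)
qed

text \<open>The 14 is 7 * 2: the Lipschitz factor on the ball of radius 3, times the factor by which
  path points may move relative to the endpoints.\<close>

lemma pavf_gradient_lipschitz:
  fixes H :: "('d::finite, 'm::{finite,linorder}) blocks \<Rightarrow> real"
  assumes H: "\<And>z. H differentiable (at z)" "continuous_on UNIV (gradient H)"
    and T: "taylor_on A L (cball z 3) (gradient H)"
    and "a \<in> cball z 1" "b \<in> cball z 1" "a' \<in> cball z 1" "b' \<in> cball z 1"
  shows "norm (pavf_gradient H a b - pavf_gradient H a' b')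
    \<le> real CARD('m) * (14 * L * (norm (a - a') + norm (b - b')))"
proof -
  have "norm (gradient H (a + path_mask k \<xi> (b - a)) + (- 1) *\<^sub>R gradient H (a' + path_mask k \<xi> (b' - a')) - 0)
      \<le> 14 * L * (norm (a - a') + norm (b - b'))" if \<xi>: "\<xi> \<in> {0..1}" for k \<xi>
  proof -
    let ?p = "a + path_mask k \<xi> (b - a)" and ?q = "a' + path_mask k \<xi> (b' - a')"
    have pq: "?p - ?q = (a - a') + path_mask k \<xi> ((b - b') - (a - a'))"
      by (simp add: path_mask_diff)
    have "norm (?p - ?q) \<le> norm (a - a') + norm ((b - b') - (a - a'))"
      unfolding pq by (intro norm_triangle_mono norm_path_mask_le[OF \<xi>]) simp
    also have "\<dots> \<le> 2 * (norm (a - a') + norm (b - b'))"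
      using norm_triangle_ineq4[of "b - b'" "a - a'"] norm_ge_zero[of "b - b'"]
      unfolding distrib_left by linarith
    finally have "L * (1 + 2 * 3) * norm (?p - ?q) \<le> L * (1 + 2 * 3) * (2 * (norm (a - a') + norm (b - b')))"
      using T by (intro mult_left_mono) (auto simp: taylor_on_def)
    moreover have "norm (gradient H ?p - gradient H ?q) \<le> L * (1 + 2 * 3) * norm (?p - ?q)"
      by (intro taylor_on_lipschitz[OF T] path_in_cball assms \<xi>)
    ultimately show ?thesis
      by (simp add: algebra_simps)
  qed
  from norm_pavf_gradient_combination_le[OF H this] show ?thesis
    by simp
qed

text \<open>
  Points with the same \<open>\<xi>\<close> on the paths from \<open>a\<close> to \<open>b\<close> and from \<open>b\<close> to \<open>a\<close> are symmetric about the
  midpoint, so the first-order terms of the gradient cancel.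
\<close>

lemma pavf_gradient_symmetric_sum:
  fixes H :: "('d::finite, 'm::{finite,linorder}) blocks \<Rightarrow> real"
  assumes H: "\<And>z. H differentiable (at z)" "continuous_on UNIV (gradient H)"
    and T: "taylor_on A L (cball z 3) (gradient H)"
    and ab: "a \<in> cball z 1" "b \<in> cball z 1"
  shows "norm (pavf_gradient H a b + pavf_gradient H b a - 2 *\<^sub>R gradient H ((1 / 2) *\<^sub>R (a + b)))
    \<le> real CARD('m) * (8 * L * (norm (b - a))\<^sup>2)"
proof -
  let ?m = "(1 / 2) *\<^sub>R (a + b)"
  have "?m \<in> cball z 1"
    using convexD[OF convex_cball ab, of "1 / 2" "1 / 2"] by (simp add: scaleR_add_right)
  then have m3: "?m \<in> cball z 3"
    unfolding mem_cball by linarith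
  have L: "0 \<le> L"
    using T by (simp add: taylor_on_def)
  have "norm (gradient H (a + path_mask k \<xi> (b - a)) + 1 *\<^sub>R gradient H (b + path_mask k \<xi> (a - b))
      - 2 *\<^sub>R gradient H ?m) \<le> 8 * L * (norm (b - a))\<^sup>2" if \<xi>: "\<xi> \<in> {0..1}" for k \<xi>
  proof -
    \<comment> \<open>\<open>d\<close> is the displacement of the path point from the midpoint,
      bounded by twice \<open>norm (b - a)\<close>; squaring this and the factor 2 of the second
      difference give the 8.\<close>
    define d where "d = path_mask k \<xi> (b - a) - (1 / 2) *\<^sub>R (b - a)"
    have half: "(1 / 2) *\<^sub>R x + (1 / 2) *\<^sub>R x = x" for x :: "('d, 'm) blocks"
      by (simp add: scaleR_half_double)
    have p: "?m + d = a + path_mask k \<xi> (b - a)"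
      using half[of a] by (simp add: d_def algebra_simps)
    have q: "?m - d = b + path_mask k \<xi> (a - b)"
      using half[of b] by (simp add: d_def path_mask_diff algebra_simps)
    have "norm d \<le> norm (b - a) + norm ((1 / 2) *\<^sub>R (b - a))"
      unfolding d_def
      by (rule order_trans[OF norm_triangle_ineq4 add_right_mono[OF norm_path_mask_le[OF \<xi>]]])
    also have "\<dots> \<le> 2 * norm (b - a)"
      by simp
    finally have "(norm d)\<^sup>2 \<le> 4 * (norm (b - a))\<^sup>2"
      using power_mono[of "norm d" "2 * norm (b - a)" 2] by (simp add: power_mult_distrib)
    then have "2 * L * (norm d)\<^sup>2 \<le> 2 * L * (4 * (norm (b - a))\<^sup>2)"
      using L by (intro mult_left_mono) auto
    moreover have "norm (gradient H (?m + d) + gradient H (?m - d) - 2 *\<^sub>R gradient H ?m) \<le> 2 * L * (norm d)\<^sup>2"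
      by (rule taylor_on_second_difference[OF T m3]) (use path_in_cball ab \<xi> in \<open>simp_all only: p q\<close>)
    ultimately show ?thesis
      unfolding p q by simp
  qed
  from norm_pavf_gradient_combination_le[OF H this] show ?thesis
    by simp
qed

text \<open>
  The same cancellation about \<open>c\<close>, up to the defect \<open>(b - c) - (c - a)\<close> by which \<open>c\<close> misses the
  midpoint of \<open>a\<close> and \<open>b\<close>.
\<close>

lemma pavf_gradient_common_endpoint_sum:
  fixes H :: "('d::finite, 'm::{finite,linorder}) blocks \<Rightarrow> real"
  assumes H: "\<And>z. H differentiable (at z)" "continuous_on UNIV (gradient H)"
    and T: "taylor_on A L (cball z 3) (gradient H)"
    and abc: "a \<in> cball z 1" "b \<in> cball z 1" "c \<in> cball z 1"
  shows "norm (pavf_gradient H a c + pavf_gradient H b c - 2 *\<^sub>R gradient H c)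
    \<le> real CARD('m) * (7 * L * norm ((b - c) - (c - a)) + 2 * L * (norm (c - a))\<^sup>2)"
proof -
  have L: "0 \<le> L"
    using T by (simp add: taylor_on_def)
  have c3: "c \<in> cball z 3"
    using abc(3) by simp
  have "norm (gradient H (a + path_mask k \<xi> (c - a)) + 1 *\<^sub>R gradient H (b + path_mask k \<xi> (c - b))
      - 2 *\<^sub>R gradient H c) \<le> 7 * L * norm ((b - c) - (c - a)) + 2 * L * (norm (c - a))\<^sup>2"
    if \<xi>: "\<xi> \<in> {0..1}" for k \<xi>
  proof -
    \<comment> \<open>Both paths end at \<open>c\<close>, so their points are reached from
      \<open>c\<close> through the complementary mask \<open>N\<close>, one on each side.\<close>
    define N where "N v = v - path_mask k \<xi> v" for v :: "('d, 'm) blocks"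
    let ?u = "N (c - a)" and ?w = "N (b - c)"
    have p: "c - ?u = a + path_mask k \<xi> (c - a)"
      by (simp add: N_def)
    have q: "c + ?w = b + path_mask k \<xi> (c - b)"
      by (simp add: N_def path_mask_diff)
    have u: "norm ?u \<le> norm (c - a)"
      unfolding N_def by (rule norm_diff_path_mask_le[OF \<xi>])
    have wu: "?w - ?u = N ((b - c) - (c - a))"
      unfolding N_def path_mask_diff by simp
    have wu_le: "norm (?w - ?u) \<le> norm ((b - c) - (c - a))"
      unfolding wu unfolding N_def by (rule norm_diff_path_mask_le[OF \<xi>])
    have p3: "c - ?u \<in> cball z 3" and q3: "c + ?w \<in> cball z 3"
      unfolding p q by (intro path_in_cball abc \<xi>)+
    \<comment> \<open>The mirror image \<open>c + ?u\<close> of the first path point serves as a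
      third point: the second difference compares it with \<open>c - ?u\<close>, the Lipschitz bound
      with the true second path point \<open>c + ?w\<close>.\<close>
    have "norm (c + ?u - z) \<le> norm (c - z) + norm ?u"
      using norm_triangle_ineq[of "c - z" ?u] by (simp add: algebra_simps)
    also have "\<dots> \<le> norm (c - z) + (norm (c - z) + norm (a - z))"
      using u norm_triangle_ineq4[of "c - z" "a - z"] by simp
    also have "\<dots> \<le> 3"
      using abc by (simp add: dist_norm norm_minus_commute)
    finally have r3: "c + ?u \<in> cball z 3"
      by (simp add: dist_norm norm_minus_commute)
    have "norm (gradient H (c + ?w) - gradient H (c + ?u)) \<le> L * (1 + 2 * 3) * norm (c + ?w - (c + ?u))"
      by (rule taylor_on_lipschitz[OF T r3 q3])
    also have "\<dots> \<le> L * (1 + 2 * 3) * norm ((b - c) - (c - a))"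
      using wu_le L by (intro mult_left_mono) auto
    finally have 1: "norm (gradient H (c + ?w) - gradient H (c + ?u)) \<le> 7 * L * norm ((b - c) - (c - a))"
      by simp
    have "norm (gradient H (c + ?u) + gradient H (c - ?u) - 2 *\<^sub>R gradient H c) \<le> 2 * L * (norm ?u)\<^sup>2"
      by (rule taylor_on_second_difference[OF T c3 r3 p3])
    also have "\<dots> \<le> 2 * L * (norm (c - a))\<^sup>2"
      using u L by (intro mult_left_mono power_mono) auto
    finally have 2: "norm (gradient H (c + ?u) + gradient H (c - ?u) - 2 *\<^sub>R gradient H c)
        \<le> 2 * L * (norm (c - a))\<^sup>2" .
    have "gradient H (a + path_mask k \<xi> (c - a)) + 1 *\<^sub>R gradient H (b + path_mask k \<xi> (c - b))
        - 2 *\<^sub>R gradient H c = (gradient H (c + ?w) - gradient H (c + ?u))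
          + (gradient H (c + ?u) + gradient H (c - ?u) - 2 *\<^sub>R gradient H c)"
      unfolding p[symmetric] q[symmetric] by simp
    moreover have "norm ((gradient H (c + ?w) - gradient H (c + ?u))
          + (gradient H (c + ?u) + gradient H (c - ?u) - 2 *\<^sub>R gradient H c))
        \<le> 7 * L * norm ((b - c) - (c - a)) + 2 * L * (norm (c - a))\<^sup>2"
      by (rule norm_triangle_mono[OF 1 2])
    ultimately show ?thesis
      by (simp only:)
  qed
  from norm_pavf_gradient_combination_le[OF H this] show ?thesis
    by simp
qed

text \<open>The centre is \<open>(z + y) / 2\<close>, about which the two discrete gradients are
  exactly symmetric. The second conclusion rules out that \<open>arg_min\<close> returns an
  unspecified value.\<close>

lemma pavf_p_order:
  fixes S :: "('d::finite, 'm::{finite,linorder}) block_matrix"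
    and H :: "('d, 'm) blocks \<Rightarrow> real"
  assumes smooth: "cont_diff 3 H"
  shows "has_order 2 (\<lambda>z. block_mult S (gradient H z)) (pavf_p S H)"
    and "\<forall>\<^sub>F \<tau> in at 0. pavf_p_step S H \<tau> z (pavf_p S H \<tau> z)"
proof -
  let ?T = "block_mult S" and ?G = "pavf_gradient H" and ?g = "gradient H" and ?N = "real CARD('m)"
  interpret T: bounded_linear ?T by (rule bounded_linear_block_mult)
  have H: "\<And>z. H differentiable (at z)" "continuous_on UNIV ?g"
    by (rule cont_diff_3_gradient[OF smooth])+
  have GC: "continuous_on UNIV (\<lambda>p. ?G (fst p) (snd p))"
    using continuous_on_pavf_gradient[OF H] unfolding case_prod_beta .
  have GC': "continuous_on UNIV (\<lambda>p. ?G (snd p) (fst p))"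
    using continuous_on_compose2[OF GC continuous_on_swap] by simp
  have F: "continuous_on UNIV (\<lambda>(a, b). (1 / 2) *\<^sub>R ?T (?G a b + ?G b a))"
    unfolding case_prod_beta by (intro continuous_on_scaleR continuous_on_const T.continuous_on continuous_on_add GC GC')
  have near: "\<exists>\<tau>\<^sub>0>0. \<exists>K>0. \<forall>\<tau>. \<tau> \<noteq> 0 \<longrightarrow> \<bar>\<tau>\<bar> < \<tau>\<^sub>0 \<longrightarrow>
      pavf_p_step S H \<tau> z (pavf_p S H \<tau> z) \<and> norm (pavf_p S H \<tau> z - z) \<le> K * \<bar>\<tau>\<bar>" for z
  proof -
    obtain \<tau>\<^sub>0 K where "0 < \<tau>\<^sub>0" "0 < K" and
      *: "\<And>\<tau> a. \<tau> \<noteq> 0 \<Longrightarrow> \<bar>\<tau>\<bar> < \<tau>\<^sub>0 \<Longrightarrow> a \<in> cball z 1 \<Longrightarrow>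
        pavf_p_step S H \<tau> a (close_solution (pavf_p_step S H) \<tau> a)
        \<and> norm (close_solution (pavf_p_step S H) \<tau> a - a) \<le> K * \<bar>\<tau>\<bar>"
    proof (rule close_solution_near[OF F, where R = "pavf_p_step S H" and z = z])
      show "pavf_p_step S H \<tau> a b \<longleftrightarrow> b - a = \<tau> *\<^sub>R (1 / 2) *\<^sub>R ?T (?G a b + ?G b a)"
        if "\<tau> \<noteq> 0" for \<tau> a b
        by (rule pavf_p_step_iff[OF that H])
    qed (rule that)
    then show ?thesis
      unfolding pavf_p_def by (intro exI[of _ \<tau>\<^sub>0] exI[of _ K]) auto
  qed
  show "\<forall>\<^sub>F \<tau> in at 0. pavf_p_step S H \<tau> z (pavf_p S H \<tau> z)"
    using near[of z] unfolding eventually_at dist_real_def by auto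
  show "has_order 2 (\<lambda>z. ?T (?g z)) (pavf_p S H)"
    unfolding has_order_def
  proof (intro allI impI)
    fix z \<phi>
    assume ex: "exact_solution (\<lambda>z. ?T (?g z)) z \<phi>"
    let ?y = "\<lambda>\<tau>. pavf_p S H \<tau> z"
    obtain \<tau>\<^sub>0 K where \<tau>\<^sub>0: "0 < \<tau>\<^sub>0" and K: "0 < K" and
      near_z: "\<And>\<tau>. \<tau> \<noteq> 0 \<Longrightarrow> \<bar>\<tau>\<bar> < \<tau>\<^sub>0 \<Longrightarrow>
        pavf_p_step S H \<tau> z (?y \<tau>) \<and> norm (?y \<tau> - z) \<le> K * \<bar>\<tau>\<bar>"
      using near[of z] by blast
    obtain A L where T3: "taylor_on A L (cball z 3) ?g"
      using gradient_taylor[OF smooth] .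
    then have L: "0 \<le> L"
      by (simp add: taylor_on_def)
    obtain A1 L1 where "taylor_on A1 L1 (cball z 1) ?g"
      using gradient_taylor[OF smooth] .
    then obtain A' L' where T1: "taylor_on A' L' (cball z 1) (\<lambda>z. ?T (?g z))"
      using taylor_on_bounded_linear[OF T.bounded_linear_axioms] by blast
    obtain M where M: "0 < M" "\<And>v. norm (?T v) \<le> M * norm v"
      using T.pos_bounded by (auto simp: mult.commute)
    have small: "\<forall>\<^sub>F \<tau> in at 0. \<tau> \<noteq> 0 \<and> \<bar>\<tau>\<bar> < \<tau>\<^sub>0 \<and> K * \<bar>\<tau>\<bar> \<le> 1"
      unfolding eventually_at dist_real_def using \<tau>\<^sub>0 K
      by (intro exI[of _ "min \<tau>\<^sub>0 (1 / K)"]) (auto simp: field_simps)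
    have scaled: "norm (c *\<^sub>R ?T v) \<le> \<bar>c\<bar> * (M * B)" if "norm v \<le> B" for c v B
      unfolding norm_scaleR real_norm_def
      using order_trans[OF M(2) mult_left_mono[OF that]] M(1) by (intro mult_left_mono) auto
    \<comment> \<open>A first-order bound is enough here: each discrete gradient differs from
      \<open>?g z\<close> by a multiple of the displacement. The 7 is 2 * 14 / 4, one factor 1/2
      coming from the method and one from the midpoint.\<close>
    have m: "\<forall>\<^sub>F \<tau> in at 0. norm ((1 / 2) *\<^sub>R (z + ?y \<tau>) - z - (\<tau> / 2) *\<^sub>R ?T (?g z))
        \<le> (M * (?N * (7 * L * K))) * \<bar>\<tau>\<bar>\<^sup>2"
      using small
    proof eventually_elim
      case (elim \<tau>)
      let ?y = "?y \<tau>"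
      have step: "?y - z = \<tau> *\<^sub>R (1 / 2) *\<^sub>R ?T (?G z ?y + ?G ?y z)" and yK: "norm (?y - z) \<le> K * \<bar>\<tau>\<bar>"
        using near_z elim pavf_p_step_iff[OF _ H] by blast+
      have z1: "z \<in> cball z 1" and y1: "?y \<in> cball z 1"
        using yK elim by (auto simp: dist_norm norm_minus_commute)
      have "norm ((?G z ?y - ?G z z) + (?G ?y z - ?G z z)) \<le> 2 * (?N * (14 * L * norm (?y - z)))"
        using norm_triangle_mono[OF pavf_gradient_lipschitz[OF H T3 z1 y1 z1 z1]
            pavf_gradient_lipschitz[OF H T3 y1 z1 z1 z1]] by (simp add: mult_ac)
      also have "\<dots> \<le> 2 * (?N * (14 * L * (K * \<bar>\<tau>\<bar>)))"
        using yK L by (intro mult_left_mono) auto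
      finally have G: "norm (?G z ?y + ?G ?y z - 2 *\<^sub>R ?g z) \<le> 2 * (?N * (14 * L * (K * \<bar>\<tau>\<bar>)))"
        by (simp add: pavf_gradient_same[OF H(1)] scaleR_2 algebra_simps)
      have "(1 / 2) *\<^sub>R (z + ?y) - z = (1 / 2) *\<^sub>R (?y - z)"
        using scaleR_half_double[of z] by (simp add: algebra_simps)
      also have "\<dots> - (\<tau> / 2) *\<^sub>R ?T (?g z) = (\<tau> / 4) *\<^sub>R ?T (?G z ?y + ?G ?y z - 2 *\<^sub>R ?g z)"
        unfolding step by (simp add: T.diff T.scaleR scaleR_diff_right)
      finally have "norm ((1 / 2) *\<^sub>R (z + ?y) - z - (\<tau> / 2) *\<^sub>R ?T (?g z))
          \<le> \<bar>\<tau> / 4\<bar> * (M * (2 * (?N * (14 * L * (K * \<bar>\<tau>\<bar>)))))"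
        using scaled[OF G, of "\<tau> / 4"] by (simp only:)
      also have "\<dots> = (M * (?N * (7 * L * K))) * \<bar>\<tau>\<bar>\<^sup>2"
        unfolding power2_eq_square by (simp add: field_simps del: abs_mult_self_eq)
      finally show ?case .
    qed
    have y: "\<forall>\<^sub>F \<tau> in at 0. norm (?y \<tau> - z - \<tau> *\<^sub>R ?T (?g ((1 / 2) *\<^sub>R (z + ?y \<tau>))))
        \<le> (M * (?N * (4 * L * K\<^sup>2))) * \<bar>\<tau>\<bar> ^ 3"
      using small
    proof eventually_elim
      case (elim \<tau>)
      let ?y = "?y \<tau>"
      have step: "?y - z = \<tau> *\<^sub>R (1 / 2) *\<^sub>R ?T (?G z ?y + ?G ?y z)" and yK: "norm (?y - z) \<le> K * \<bar>\<tau>\<bar>"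
        using near_z elim pavf_p_step_iff[OF _ H] by blast+
      have z1: "z \<in> cball z 1" and y1: "?y \<in> cball z 1"
        using yK elim by (auto simp: dist_norm norm_minus_commute)
      let ?gm = "?g ((1 / 2) *\<^sub>R (z + ?y))"
      note pavf_gradient_symmetric_sum[OF H T3 z1 y1]
      also have "?N * (8 * L * (norm (?y - z))\<^sup>2) \<le> ?N * (8 * L * (K * \<bar>\<tau>\<bar>)\<^sup>2)"
        using yK L by (intro mult_left_mono power_mono) auto
      finally have G: "norm (?G z ?y + ?G ?y z - 2 *\<^sub>R ?gm) \<le> ?N * (8 * L * (K * \<bar>\<tau>\<bar>)\<^sup>2)" .
      have "?y - z - \<tau> *\<^sub>R ?T ?gm = (\<tau> / 2) *\<^sub>R ?T (?G z ?y + ?G ?y z - 2 *\<^sub>R ?gm)"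
        unfolding step by (simp add: T.diff T.scaleR scaleR_diff_right)
      then show ?case
        using scaled[OF G, of "\<tau> / 2"]
        by (simp add: power2_eq_square power3_eq_cube power_mult_distrib mult_ac)
    qed
    show "(\<lambda>\<tau>. norm (?y \<tau> - \<phi> \<tau>)) \<in> O[at 0](\<lambda>\<tau>. \<tau> ^ (2 + 1))"
      using order_two_via_midpoint[OF ex T1 m y] by simp
  qed
qed

text \<open>The adjoint half-step uses the discrete gradient from \<open>y\<close> to
  \<open>c\<close>, so both half-steps have paths ending at the intermediate value \<open>c\<close>,
  which acts as the centre. It is the midpoint of \<open>z\<close> and \<open>y\<close> only
  approximately.\<close>

lemma pavf_c_order:
  fixes S :: "('d::finite, 'm::{finite,linorder}) block_matrix"
    and H :: "('d, 'm) blocks \<Rightarrow> real"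
  assumes smooth: "cont_diff 3 H"
  shows "has_order 2 (\<lambda>z. block_mult S (gradient H z)) (pavf_c S H)"
    and "\<forall>\<^sub>F \<tau> in at 0. pavf_c_step S H \<tau> z (pavf_c S H \<tau> z)"
proof -
  let ?T = "block_mult S" and ?G = "pavf_gradient H" and ?g = "gradient H" and ?N = "real CARD('m)"
  interpret T: bounded_linear ?T by (rule bounded_linear_block_mult)
  have H: "\<And>z. H differentiable (at z)" "continuous_on UNIV ?g"
    by (rule cont_diff_3_gradient[OF smooth])+
  have GC: "continuous_on UNIV (\<lambda>p. ?G (fst p) (snd p))"
    using continuous_on_pavf_gradient[OF H] unfolding case_prod_beta .
  have GC': "continuous_on UNIV (\<lambda>p. ?G (snd p) (fst p))"
    using continuous_on_compose2[OF GC continuous_on_swap] by simp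
  have F: "continuous_on UNIV (\<lambda>(a, b). ?T (?G a b))" "continuous_on UNIV (\<lambda>(a, b). ?T (?G b a))"
    unfolding case_prod_beta by (intro T.continuous_on GC GC')+
  let ?c = "\<lambda>z \<tau>. pavf S H (\<tau> / 2) z" and ?y = "\<lambda>z \<tau>. pavf_c S H \<tau> z"
  have near: "\<exists>\<tau>\<^sub>0>0. \<exists>K>0. \<forall>\<tau>. \<tau> \<noteq> 0 \<longrightarrow> \<bar>\<tau>\<bar> < \<tau>\<^sub>0 \<longrightarrow> K * \<bar>\<tau>\<bar> \<le> 1 \<and>
      pavf_step S H (\<tau> / 2) z (?c z \<tau>) \<and> pavf_adj_step S H (\<tau> / 2) (?c z \<tau>) (?y z \<tau>) \<and>
      norm (?c z \<tau> - z) \<le> K * \<bar>\<tau>\<bar> \<and> norm (?y z \<tau> - z) \<le> K * \<bar>\<tau>\<bar>" for z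
  proof -
    obtain \<tau>\<^sub>1 K1 where "0 < \<tau>\<^sub>1" "0 < K1"
      "\<And>\<tau> a. \<tau> \<noteq> 0 \<Longrightarrow> \<bar>\<tau>\<bar> < \<tau>\<^sub>1 \<Longrightarrow> a \<in> cball z 1 \<Longrightarrow>
        pavf_step S H \<tau> a (close_solution (pavf_step S H) \<tau> a)
        \<and> norm (close_solution (pavf_step S H) \<tau> a - a) \<le> K1 * \<bar>\<tau>\<bar>"
    proof (rule close_solution_near[OF F(1), where R = "pavf_step S H" and z = z])
      show "pavf_step S H \<tau> a b \<longleftrightarrow> b - a = \<tau> *\<^sub>R ?T (?G a b)" if "\<tau> \<noteq> 0" for \<tau> a b
        by (rule pavf_step_iff[OF that])
    qed (rule that)
    note 1 = this(1,2) and step1 = this(3)[folded pavf_def]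
    obtain \<tau>\<^sub>2 K2 where "0 < \<tau>\<^sub>2" "0 < K2"
      "\<And>\<tau> a. \<tau> \<noteq> 0 \<Longrightarrow> \<bar>\<tau>\<bar> < \<tau>\<^sub>2 \<Longrightarrow> a \<in> cball z 1 \<Longrightarrow>
        pavf_adj_step S H \<tau> a (close_solution (pavf_adj_step S H) \<tau> a)
        \<and> norm (close_solution (pavf_adj_step S H) \<tau> a - a) \<le> K2 * \<bar>\<tau>\<bar>"
    proof (rule close_solution_near[OF F(2), where R = "pavf_adj_step S H" and z = z])
      show "pavf_adj_step S H \<tau> a b \<longleftrightarrow> b - a = \<tau> *\<^sub>R ?T (?G b a)" if "\<tau> \<noteq> 0" for \<tau> a b
        by (rule pavf_adj_step_iff[OF that H])
    qed (rule that)
    note 2 = this(1,2) and step2 = this(3)[folded pavf_adj_def]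
    \<comment> \<open>The displacements of the two half-steps add up, so the sum bounds the distance
      from \<open>z\<close> of both the intermediate value and the result.\<close>
    define K where "K = K1 + K2"
    have K: "0 < K" "K1 \<le> K"
      using 1 2 by (auto simp: K_def)
    show ?thesis
    proof (rule exI[of _ "min (min \<tau>\<^sub>1 \<tau>\<^sub>2) (1 / K)"], rule conjI[rotated], rule exI[of _ K],
        intro conjI allI impI)
      fix \<tau> :: real
      assume "\<tau> \<noteq> 0" "\<bar>\<tau>\<bar> < min (min \<tau>\<^sub>1 \<tau>\<^sub>2) (1 / K)"
      then have \<tau>: "\<tau> / 2 \<noteq> 0" "\<bar>\<tau> / 2\<bar> < \<tau>\<^sub>1" "\<bar>\<tau> / 2\<bar> < \<tau>\<^sub>2" and K\<tau>: "K * \<bar>\<tau>\<bar> \<le> 1"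
        using K by (auto simp: field_simps)
      show "K * \<bar>\<tau>\<bar> \<le> 1" by (rule K\<tau>)
      have s1: "pavf_step S H (\<tau> / 2) z (?c z \<tau>)" and n1: "norm (?c z \<tau> - z) \<le> K1 * \<bar>\<tau> / 2\<bar>"
        using step1[OF \<tau>(1,2)] by auto
      show "pavf_step S H (\<tau> / 2) z (?c z \<tau>)" by (rule s1)
      have half: "K1 * \<bar>\<tau> / 2\<bar> \<le> K1 * \<bar>\<tau>\<bar>" "K2 * \<bar>\<tau> / 2\<bar> \<le> K2 * \<bar>\<tau>\<bar>"
        using 1 2 by (auto intro!: mult_left_mono)
      have K1\<tau>: "K1 * \<bar>\<tau>\<bar> \<le> K * \<bar>\<tau>\<bar>"
        using K(2) by (intro mult_right_mono) auto
      show n: "norm (?c z \<tau> - z) \<le> K * \<bar>\<tau>\<bar>"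
        using n1 half K1\<tau> by linarith
      then have c1: "?c z \<tau> \<in> cball z 1"
        using K\<tau> by (simp add: dist_norm norm_minus_commute)
      have s2: "pavf_adj_step S H (\<tau> / 2) (?c z \<tau>) (?y z \<tau>)" and n2: "norm (?y z \<tau> - ?c z \<tau>) \<le> K2 * \<bar>\<tau> / 2\<bar>"
        using step2[OF \<tau>(1,3) c1] by (auto simp: pavf_c_def)
      show "pavf_adj_step S H (\<tau> / 2) (?c z \<tau>) (?y z \<tau>)" by (rule s2)
      have "norm (?y z \<tau> - z) \<le> norm (?y z \<tau> - ?c z \<tau>) + norm (?c z \<tau> - z)"
        using norm_triangle_ineq[of "?y z \<tau> - ?c z \<tau>" "?c z \<tau> - z"] by simp
      then show "norm (?y z \<tau> - z) \<le> K * \<bar>\<tau>\<bar>"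
        using n1 n2 half unfolding K_def distrib_right by linarith
    qed (use 1 2 K in auto)
  qed
  show "\<forall>\<^sub>F \<tau> in at 0. pavf_c_step S H \<tau> z (pavf_c S H \<tau> z)"
    using near[of z] unfolding eventually_at dist_real_def pavf_c_step_def by (auto; blast)
  show "has_order 2 (\<lambda>z. ?T (?g z)) (pavf_c S H)"
    unfolding has_order_def
  proof (intro allI impI)
    fix z \<phi>
    assume ex: "exact_solution (\<lambda>z. ?T (?g z)) z \<phi>"
    let ?c = "?c z" and ?y = "?y z"
    obtain \<tau>\<^sub>0 K where \<tau>\<^sub>0: "0 < \<tau>\<^sub>0" and K: "0 < K" and
      near_z: "\<And>\<tau>. \<tau> \<noteq> 0 \<Longrightarrow> \<bar>\<tau>\<bar> < \<tau>\<^sub>0 \<Longrightarrow> K * \<bar>\<tau>\<bar> \<le> 1 \<and>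
        pavf_step S H (\<tau> / 2) z (?c \<tau>) \<and> pavf_adj_step S H (\<tau> / 2) (?c \<tau>) (?y \<tau>) \<and>
        norm (?c \<tau> - z) \<le> K * \<bar>\<tau>\<bar> \<and> norm (?y \<tau> - z) \<le> K * \<bar>\<tau>\<bar>"
      using near[of z] by blast
    obtain A L where T3: "taylor_on A L (cball z 3) ?g"
      using gradient_taylor[OF smooth] .
    then have L: "0 \<le> L"
      by (simp add: taylor_on_def)
    obtain A1 L1 where "taylor_on A1 L1 (cball z 1) ?g"
      using gradient_taylor[OF smooth] .
    then obtain A' L' where T1: "taylor_on A' L' (cball z 1) (\<lambda>z. ?T (?g z))"
      using taylor_on_bounded_linear[OF T.bounded_linear_axioms] by blast
    obtain M where M: "0 < M" "\<And>v. norm (?T v) \<le> M * norm v"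
      using T.pos_bounded by (auto simp: mult.commute)
    have small: "\<forall>\<^sub>F \<tau> in at 0. \<tau> \<noteq> 0 \<and> \<bar>\<tau>\<bar> < \<tau>\<^sub>0"
      unfolding eventually_at dist_real_def using \<tau>\<^sub>0 by auto
    have scaled: "norm (c *\<^sub>R ?T v) \<le> \<bar>c\<bar> * (M * B)" if "norm v \<le> B" for c v B
      unfolding norm_scaleR real_norm_def
      using order_trans[OF M(2) mult_left_mono[OF that]] M(1) by (intro mult_left_mono) auto
    define P where "P = ?N * (14 * L * K)"
    have lip: "norm (?G a b - ?G a' b') \<le> P * \<bar>\<tau>\<bar>"
      if "a \<in> cball z 1" "b \<in> cball z 1" "a' \<in> cball z 1" "b' \<in> cball z 1"
        "norm (a - a') + norm (b - b') \<le> K * \<bar>\<tau>\<bar>" for a b a' b' \<tau>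
    proof -
      have "?N * (14 * L * (norm (a - a') + norm (b - b'))) \<le> ?N * (14 * L * (K * \<bar>\<tau>\<bar>))"
        using that(5) L by (intro mult_left_mono) auto
      then show ?thesis
        using pavf_gradient_lipschitz[OF H T3 that(1-4)] by (simp add: P_def mult_ac)
    qed
    have m: "\<forall>\<^sub>F \<tau> in at 0. norm (?c \<tau> - z - (\<tau> / 2) *\<^sub>R ?T (?g z)) \<le> (M * P / 2) * \<bar>\<tau>\<bar>\<^sup>2"
      using small
    proof eventually_elim
      case (elim \<tau>)
      then have step: "?c \<tau> - z = (\<tau> / 2) *\<^sub>R ?T (?G z (?c \<tau>))" and cK: "norm (?c \<tau> - z) \<le> K * \<bar>\<tau>\<bar>"
        and K1: "K * \<bar>\<tau>\<bar> \<le> 1"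
        using near_z[of \<tau>] pavf_step_iff[of "\<tau> / 2" S H z "?c \<tau>"] by auto
      have z1: "z \<in> cball z 1" and c1: "?c \<tau> \<in> cball z 1"
        using cK K1 by (auto simp: dist_norm norm_minus_commute)
      have "norm (?G z (?c \<tau>) - ?g z) \<le> P * \<bar>\<tau>\<bar>"
        using lip[OF z1 c1 z1 z1] cK by (simp add: pavf_gradient_same[OF H(1)])
      from scaled[OF this, of "\<tau> / 2"] show ?case
        unfolding step by (simp add: T.diff scaleR_diff_right power2_eq_square mult_ac)
    qed
    have y: "\<forall>\<^sub>F \<tau> in at 0. norm (?y \<tau> - z - \<tau> *\<^sub>R ?T (?g (?c \<tau>)))
        \<le> (M * (?N * (7 * L * (M * P / 2) + 2 * L * K\<^sup>2)) / 2) * \<bar>\<tau>\<bar> ^ 3"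
      using small
    proof eventually_elim
      case (elim \<tau>)
      let ?c = "?c \<tau>" and ?y = "?y \<tau>"
      have step1: "?c - z = (\<tau> / 2) *\<^sub>R ?T (?G z ?c)" and step2: "?y - ?c = (\<tau> / 2) *\<^sub>R ?T (?G ?y ?c)"
        and cK: "norm (?c - z) \<le> K * \<bar>\<tau>\<bar>" and yK: "norm (?y - z) \<le> K * \<bar>\<tau>\<bar>" and K1: "K * \<bar>\<tau>\<bar> \<le> 1"
        using elim near_z[of \<tau>] pavf_step_iff[of "\<tau> / 2" S H z ?c]
          pavf_adj_step_iff[OF _ H, of "\<tau> / 2" S ?c ?y] by auto
      have z1: "z \<in> cball z 1" and c1: "?c \<in> cball z 1" and y1: "?y \<in> cball z 1"
        using cK yK K1 by (auto simp: dist_norm norm_minus_commute)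
      \<comment> \<open>The half-steps differ only in the first argument, \<open>z\<close> against
        \<open>?y\<close>, which are O(\<tau>) apart. With the prefactor \<open>\<tau> / 2\<close>,
        the intermediate value misses the midpoint by O(\<tau>^2) only.\<close>
      have dG: "norm (?G ?y ?c - ?G z ?c) \<le> P * \<bar>\<tau>\<bar>"
        using lip[OF y1 c1 z1 c1] yK by simp
      have "norm ((?y - ?c) - (?c - z)) \<le> (M * P / 2) * \<bar>\<tau>\<bar>\<^sup>2"
        using scaled[OF dG, of "\<tau> / 2"] unfolding step1 step2
        by (simp add: T.diff scaleR_diff_right power2_eq_square mult_ac)
      then have "7 * L * norm ((?y - ?c) - (?c - z)) + 2 * L * (norm (?c - z))\<^sup>2
          \<le> 7 * L * ((M * P / 2) * \<bar>\<tau>\<bar>\<^sup>2) + 2 * L * (K * \<bar>\<tau>\<bar>)\<^sup>2"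
        using cK L by (intro add_mono mult_left_mono power_mono) auto
      also have "\<dots> = (7 * L * (M * P / 2) + 2 * L * K\<^sup>2) * \<bar>\<tau>\<bar>\<^sup>2"
        by (simp add: power_mult_distrib algebra_simps)
      finally have "?N * (7 * L * norm ((?y - ?c) - (?c - z)) + 2 * L * (norm (?c - z))\<^sup>2)
          \<le> ?N * ((7 * L * (M * P / 2) + 2 * L * K\<^sup>2) * \<bar>\<tau>\<bar>\<^sup>2)"
        by (intro mult_left_mono) auto
      with pavf_gradient_common_endpoint_sum[OF H T3 z1 y1 c1]
      have G: "norm (?G z ?c + ?G ?y ?c - 2 *\<^sub>R ?g ?c)
          \<le> ?N * ((7 * L * (M * P / 2) + 2 * L * K\<^sup>2) * \<bar>\<tau>\<bar>\<^sup>2)"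
        by (rule order_trans)
      have "?y - z - \<tau> *\<^sub>R ?T (?g ?c) = (?y - ?c) + (?c - z) - \<tau> *\<^sub>R ?T (?g ?c)"
        by simp
      also have "\<dots> = (\<tau> / 2) *\<^sub>R ?T (?G z ?c + ?G ?y ?c - 2 *\<^sub>R ?g ?c)"
        unfolding step1 step2 by (simp add: T.diff T.add T.scaleR scaleR_diff_right scaleR_add_right)
      finally have "norm (?y - z - \<tau> *\<^sub>R ?T (?g ?c))
          \<le> \<bar>\<tau> / 2\<bar> * (M * (?N * ((7 * L * (M * P / 2) + 2 * L * K\<^sup>2) * \<bar>\<tau>\<bar>\<^sup>2)))"
        using scaled[OF G, of "\<tau> / 2"] by (simp only:)
      also have "\<dots> = (M * (?N * (7 * L * (M * P / 2) + 2 * L * K\<^sup>2)) / 2) * \<bar>\<tau>\<bar> ^ 3"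
        by (simp only: abs_divide abs_numeral power2_eq_square power3_eq_cube times_divide_eq_left
            times_divide_eq_right mult_ac)
      finally show ?case .
    qed
    show "(\<lambda>\<tau>. norm (?y \<tau> - \<phi> \<tau>)) \<in> O[at 0](\<lambda>\<tau>. \<tau> ^ (2 + 1))"
      using order_two_via_midpoint[OF ex T1 m y] by simp
  qed
qed

text \<open>The eventual statements certify that for small \<tau> the maps return genuine solutions
  of their relations; combined with the energy laws for the relations, they give conservation along
  the maps.\<close>

theorem theorem2p2:
  fixes S :: "('d::finite, 'm::{finite,linorder}) block_matrix"
    and H :: "('d, 'm) blocks \<Rightarrow> real"
  assumes skew: "transpose S = - S"
    and smooth: "cont_diff 3 H"
  shows "has_order 2 (\<lambda>z. block_mult S (gradient H z)) (pavf_c S H)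
    \<and> has_order 2 (\<lambda>z. block_mult S (gradient H z)) (pavf_p S H)
    \<and> (\<forall>z. \<forall>\<^sub>F \<tau> in at 0. pavf_c_step S H \<tau> z (pavf_c S H \<tau> z))
    \<and> (\<forall>z. \<forall>\<^sub>F \<tau> in at 0. pavf_p_step S H \<tau> z (pavf_p S H \<tau> z))
    \<and> (\<forall>\<tau> z z'. \<tau> \<noteq> 0 \<longrightarrow> pavf_c_step S H \<tau> z z' \<longrightarrow> H z' = H z)
    \<and> (\<forall>\<tau> z z'. \<tau> \<noteq> 0 \<longrightarrow> pavf_p_step S H \<tau> z z' \<longrightarrow> H z' = H z)"
proof -
  have H: "\<And>z. H differentiable (at z)" "continuous_on UNIV (gradient H)"
    by (rule cont_diff_3_gradient[OF smooth])+
  show ?thesis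
    using pavf_c_order[OF smooth] pavf_p_order[OF smooth]
      pavf_c_step_energy[OF skew H] pavf_p_step_energy[OF skew H] by blast
qed

end
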